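(* Let $\Phi:(0,\infty)\to\mathbb{R}$ be $C^\infty$ with $\Phi'(s)>0$ for all $s>0$ and $\Phi(\infty):=\lim_{s\to\infty}\Phi(s)$ finite. Let $u_0:[a,b]\to[0,1]$ be continuous and strictly increasing with $u_0(a)=0$, $u_0(b)=1$, and $C^1$ in $(a,b)$ with $u_0'$ bounded below by a positive constant. Let $w$ be the solution of the conjugate problem $(\mathrm{P}_{\mathrm{c}})$, $T\in(0,\infty]$ its extinction time, and $X(u,t)$ the associated integrated function, all as defined in the context, and set $$l(t)=\lim_{u\to0^+}X(u,t),\qquad r(t)=\lim_{u\to1^-}X(u,t).$$ Then the curves $l$ and $r$ are continuous and monotone for all $0<t<T$, with $a\le l(t)<r(t)\le b$; more precisely, $l$ is nondecreasing and $r$ is nonincreasing. Moreover $r(t)-l(t)\to0$ as $t\to T$.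
   Context: Conjugate flux function: $\Psi(s)=-\Phi(1/s)$ for $s>0$, extended continuously to $s=0$ by $\Psi(0)=-\Phi(\infty)$. Conjugate initial data: $w_0(u)=1/u_0'(h(u))$ for $0<u<1$, where $h=u_0^{-1}:[0,1]\to[a,b]$. It is positive, bounded and continuous in $(0,1)$. Conjugate problem $(\mathrm{P}_{\mathrm{c}})$: $w_t=(\Psi(w))_{uu}$ for $0<u<1$, $t>0$; $w(u,0)=w_0(u)$ for $0<u<1$; $w(0,t)=w(1,t)=0$ for $t>0$. Its solution $w\ge0$ is the unique bounded (weak) solution, obtained as the monotone limit as $\varepsilon\downarrow0$ of the classical solutions $w_\varepsilon\ge\varepsilon$ of the same equation with initial data $w_0+\varepsilon$ and boundary values $\varepsilon$. The time $T\in(0,\infty]$ is the extinction time of $w$, i.e. the supremum of the times at which $w(\cdot,t)$ is not identically zero; $w$ is positive and classical in $\{0<u<1,\ 0<t<T\}$, and $w(\cdot,t)\to0$ uniformly as $t\to T$. Integrated function: $z(u,t)=\int_\Gamma w\,du+(\Psi(w))_u\,dt$, where $\Gamma$ is any piecewise smooth curve from $(1/2,0)$ to $(u,t)$; equivalently, $z$ is the continuous function on $(0,1)\times[0,T)$, smooth for $t>0$, with $z_u=w$, $z_t=(\Psi(w))_u$ and $z(1/2,0)=0$. Set $X(u,t)=x_0+z(u,t)$, where $x_0\in(a,b)$ is the point with $u_0(x_0)=1/2$ (so $X(u,0)=u_0^{-1}(u)$). Since $X$ is increasing in $u$, the limits defining $l$ and $r$ make sense. *)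

theory Defs
  imports "HOL-Analysis.Analysis"
begin

text \<open>Class C^k on an open set, for maps between real normed spaces. On a finite-dimensional
  domain the recursion through all directional derivatives gives the usual notion.\<close>

primrec Ck_on :: "nat \<Rightarrow> 'a::real_normed_vector set \<Rightarrow> ('a \<Rightarrow> 'b::real_normed_vector) \<Rightarrow> bool" where
  "Ck_on 0 S f \<longleftrightarrow> continuous_on S f"
| "Ck_on (Suc k) S f \<longleftrightarrow>
     (\<forall>x\<in>S. f differentiable (at x)) \<and> (\<forall>v. Ck_on k S (\<lambda>x. frechet_derivative f (at x) v))"

definition smooth_on :: "'a::real_normed_vector set \<Rightarrow> ('a \<Rightarrow> 'b::real_normed_vector) \<Rightarrow> bool" where
  "smooth_on S f \<longleftrightarrow> (\<forall>k. Ck_on k S f)"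

text \<open>The conjugate flux \<open>\<Psi>\<close>; the argument \<open>L\<close> is \<open>\<Phi>(\<infinity>)\<close>. Only the values at \<open>s \<ge> 0\<close> matter.\<close>

definition conj_flux :: "(real \<Rightarrow> real) \<Rightarrow> real \<Rightarrow> real \<Rightarrow> real" where
  "conj_flux \<Phi> L s = (if s = 0 then - L else - \<Phi> (1 / s))"

definition conj_init :: "real \<Rightarrow> real \<Rightarrow> (real \<Rightarrow> real) \<Rightarrow> real \<Rightarrow> real" where
  "conj_init a b u0 u = 1 / deriv u0 (the_inv_into {a..b} u0 u)"

text \<open>Functions of space and time are curried, space variable \<open>u\<close> first. The closed parabolic
  domain omits the corners \<open>(0,0)\<close> and \<open>(1,0)\<close>, where initial and boundary values need not
  be compatible.\<close>

definition par_dom :: "(real \<times> real) set" where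
  "par_dom = {0..1} \<times> {0<..} \<union> {0<..<1} \<times> {0..}"

text \<open>Continuous derivatives \<open>f\<^sub>u\<close>, \<open>f\<^sub>u\<^sub>u\<close>, \<open>f\<^sub>t\<close>.\<close>

definition C21_on :: "(real \<times> real) set \<Rightarrow> (real \<Rightarrow> real \<Rightarrow> real) \<Rightarrow> bool" where
  "C21_on S f \<longleftrightarrow> (\<exists>fu fuu ft.
     continuous_on S (\<lambda>(u, t). fu u t) \<and>
     continuous_on S (\<lambda>(u, t). fuu u t) \<and>
     continuous_on S (\<lambda>(u, t). ft u t) \<and>
     (\<forall>(u, t)\<in>S. ((\<lambda>v. f v t) has_real_derivative fu u t) (at u) \<and>
                 ((\<lambda>v. fu v t) has_real_derivative fuu u t) (at u) \<and>
                 (f u has_real_derivative ft u t) (at t)))"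

text \<open>Bounded classical solutions of \<open>w\<^sub>t = (\<Psi>(w))\<^sub>u\<^sub>u\<close> on \<open>0 < u < 1\<close>, \<open>t > 0\<close> with
  \<open>w \<ge> \<epsilon>\<close>, initial data \<open>w\<^sub>0 + \<epsilon>\<close> and boundary values \<open>\<epsilon>\<close>.\<close>

definition classical_solution ::
  "(real \<Rightarrow> real) \<Rightarrow> (real \<Rightarrow> real) \<Rightarrow> real \<Rightarrow> (real \<Rightarrow> real \<Rightarrow> real) \<Rightarrow> bool" where
  "classical_solution \<Psi> w0 \<epsilon> w \<longleftrightarrow>
     continuous_on par_dom (\<lambda>(u, t). w u t) \<and>
     bounded ((\<lambda>(u, t). w u t) ` par_dom) \<and>
     (\<forall>(u, t)\<in>par_dom. \<epsilon> \<le> w u t) \<and>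
     C21_on ({0<..<1} \<times> {0<..}) w \<and>
     (\<forall>u\<in>{0<..<1}. \<forall>t>0. deriv (w u) t = deriv (deriv (\<lambda>v. \<Psi> (w v t))) u) \<and>
     (\<forall>u\<in>{0<..<1}. w u 0 = w0 u + \<epsilon>) \<and>
     (\<forall>t>0. w 0 t = \<epsilon> \<and> w 1 t = \<epsilon>)"

text \<open>The solution of the conjugate problem, as the monotone limit of the classical solutions
  \<open>w\<^sub>\<epsilon>\<close> as \<open>\<epsilon>\<close> decreases to \<open>0\<close>.\<close>

definition conj_solution ::
  "(real \<Rightarrow> real) \<Rightarrow> (real \<Rightarrow> real) \<Rightarrow> (real \<Rightarrow> real \<Rightarrow> real) \<Rightarrow> bool" where
  "conj_solution \<Psi> w0 w \<longleftrightarrow> (\<exists>W.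
     (\<forall>\<epsilon>>0. classical_solution \<Psi> w0 \<epsilon> (W \<epsilon>)) \<and>
     (\<forall>(u, t)\<in>par_dom. mono_on {0<..} (\<lambda>\<epsilon>. W \<epsilon> u t) \<and>
                       ((\<lambda>\<epsilon>. W \<epsilon> u t) \<longlongrightarrow> w u t) (at_right 0)))"

definition extinction_time :: "(real \<Rightarrow> real \<Rightarrow> real) \<Rightarrow> ereal" where
  "extinction_time w = Sup (ereal ` {t. 0 \<le> t \<and> (\<exists>u\<in>{0<..<1}. w u t \<noteq> 0)})"

text \<open>The potential \<open>z\<close> of the closed form \<open>w du + (\<Psi>(w))\<^sub>u dt\<close> vanishing at \<open>(1/2, 0)\<close>. These
  conditions determine \<open>z\<close> on \<open>(0,1) \<times> [0,T)\<close>. They are used in place of line integrals since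
  \<open>(\<Psi>(w))\<^sub>u\<close> need not be integrable in time down to \<open>t = 0\<close>.\<close>

definition integrated_function ::
  "(real \<Rightarrow> real) \<Rightarrow> (real \<Rightarrow> real \<Rightarrow> real) \<Rightarrow> ereal \<Rightarrow> (real \<Rightarrow> real \<Rightarrow> real) \<Rightarrow> bool" where
  "integrated_function \<Psi> w T z \<longleftrightarrow>
     continuous_on ({0<..<1} \<times> {t. 0 \<le> t \<and> ereal t < T}) (\<lambda>(u, t). z u t) \<and>
     smooth_on ({0<..<1} \<times> {t. 0 < t \<and> ereal t < T}) (\<lambda>(u, t). z u t) \<and>
     (\<forall>u\<in>{0<..<1}. \<forall>t. 0 \<le> t \<and> ereal t < T \<longrightarrow>
        ((\<lambda>v. z v t) has_real_derivative w u t) (at u)) \<and>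
     (\<forall>u\<in>{0<..<1}. \<forall>t. 0 < t \<and> ereal t < T \<longrightarrow>
        (\<exists>q. ((\<lambda>v. \<Psi> (w v t)) has_real_derivative q) (at u) \<and>
             (z u has_real_derivative q) (at t))) \<and>
     z (1/2) 0 = 0"

definition left_curve :: "(real \<Rightarrow> real \<Rightarrow> real) \<Rightarrow> real \<Rightarrow> real" where
  "left_curve X t = Lim (at_right 0) (\<lambda>u. X u t)"

definition right_curve :: "(real \<Rightarrow> real \<Rightarrow> real) \<Rightarrow> real \<Rightarrow> real" where
  "right_curve X t = Lim (at_left 1) (\<lambda>u. X u t)"

end

theory Submission
  imports Defs
begin

text \<open>Since \<open>0 \<le> z\<^sub>u = w \<le> M\<close>, the functions \<open>z(u, \<cdot>)\<close> converge uniformly as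
  \<open>u \<rightarrow> 0\<close> and \<open>u \<rightarrow> 1\<close>, which makes \<open>l\<close> and \<open>r\<close> continuous on \<open>[0, T)\<close>. As
  \<open>w \<le> W\<^sub>\<epsilon>\<close> and \<open>W\<^sub>\<epsilon>\<close> is continuous up to the lateral boundary, \<open>w\<close> tends to \<open>0\<close> there
  and \<open>\<Psi>(w)\<close> tends to its minimum \<open>\<Psi>(0)\<close>; so mass only flows out, and integrating
  \<open>z\<^sub>t = \<Psi>(w)\<^sub>u\<close> in space yields the monotonicity. The bounds \<open>a\<close> and \<open>b\<close> come from
  \<open>X(u, 0) = u\<^sub>0\<^sup>-\<^sup>1(u)\<close>. If the mass \<open>r - l\<close> vanished at some \<open>t < T\<close>, then by Dini and the
  maximum principle for \<open>W\<^sub>\<epsilon>\<close> it would vanish from \<open>t\<close> on.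

  To see that the mass tends to \<open>0\<close>, test the equation for \<open>W\<^sub>\<epsilon>\<close> with \<open>(u - \<alpha>)(1 - \<alpha> - u)\<close>.
  The resulting moment has a time derivative bounded below independently of \<open>\<epsilon>\<close>, and is
  arbitrarily small after a finite \<open>T\<close>; if \<open>T = \<infinity>\<close>, a persistent mass would force it to
  decrease at a fixed positive rate.\<close>

subsection \<open>Real analysis\<close>

lemma has_integral_DERIV:
  fixes f f' :: "real \<Rightarrow> real"
  assumes "\<alpha> \<le> \<beta>" "\<And>u. u \<in> {\<alpha>..\<beta>} \<Longrightarrow> (f has_real_derivative f' u) (at u)"
  shows "(f' has_integral (f \<beta> - f \<alpha>)) {\<alpha>..\<beta>}"
  using assms
  by (intro fundamental_theorem_of_calculus)
     (simp_all add: has_real_derivative_iff_has_vector_derivative[symmetric]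
        has_field_derivative_at_within)

lemma DERIV_integral_parameter:
  fixes f f' :: "real \<Rightarrow> real \<Rightarrow> real"
  assumes deriv: "\<And>u s. u \<in> {\<alpha>..\<beta>} \<Longrightarrow> s \<in> I \<Longrightarrow> (f u has_real_derivative f' u s) (at s)"
    and cont: "\<And>s. s \<in> I \<Longrightarrow> continuous_on {\<alpha>..\<beta>} (\<lambda>u. f u s)"
    and cont': "continuous_on ({\<alpha>..\<beta>} \<times> I) (\<lambda>(u, s). f' u s)"
    and I: "open I" "convex I" "t \<in> I"
  shows "((\<lambda>s. integral {\<alpha>..\<beta>} (\<lambda>u. f u s)) has_real_derivative
          integral {\<alpha>..\<beta>} (\<lambda>u. f' u t)) (at t)"
proof -
  \<comment> \<open>The library's Leibniz rule takes the parameter as first variable, so the pair is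
    swapped.\<close>
  have "continuous_on (I \<times> cbox \<alpha> \<beta>) (\<lambda>x. (snd x, fst x))"
    by (intro continuous_intros)
  then have "continuous_on (I \<times> cbox \<alpha> \<beta>) (\<lambda>x. case (snd x, fst x) of (u, s) \<Rightarrow> f' u s)"
    by (rule continuous_on_compose2[OF cont']) auto
  then have "continuous_on (I \<times> cbox \<alpha> \<beta>) (\<lambda>(s, u). f' u s)"
    by (simp add: case_prod_unfold)
  note cont'' = this
  have "((\<lambda>s. integral (cbox \<alpha> \<beta>) (\<lambda>u. f u s)) has_real_derivative
          integral (cbox \<alpha> \<beta>) (\<lambda>u. f' u t)) (at t within I)"
  proof (rule leibniz_rule_field_derivative[OF _ _ cont'' I(3) I(2)])
    fix s u assume "s \<in> I" "u \<in> cbox \<alpha> \<beta>"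
    then show "(f u has_real_derivative f' u s) (at s within I)"
      by (simp add: has_field_derivative_at_within deriv)
  next
    fix s assume "s \<in> I"
    then show "(\<lambda>u. f u s) integrable_on cbox \<alpha> \<beta>"
      by (simp add: integrable_continuous_real cont)
  qed
  then show ?thesis
    using at_within_open[OF I(3,1)] by simp
qed

text \<open>If \<open>D > 0\<close>, then \<open>g'\<close> vanishes at \<open>x\<close> and is
  positive just to the right of it, so \<open>g\<close> would rise above its maximum.\<close>

lemma second_DERIV_nonpos_at_max:
  fixes g g' :: "real \<Rightarrow> real"
  assumes x: "x \<in> {p<..<q}"
    and g: "\<And>y. y \<in> {p<..<q} \<Longrightarrow> (g has_real_derivative g' y) (at y)"
    and g': "(g' has_real_derivative D) (at x)"
    and max: "\<And>y. y \<in> {p<..<q} \<Longrightarrow> g y \<le> g x"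
  shows "D \<le> 0"
proof (rule ccontr)
  assume "\<not> D \<le> 0"
  then have "D > 0" by simp
  have "g' x = 0"
  proof (rule DERIV_local_max[OF g[OF x]])
    show "0 < min (x - p) (q - x)" using x by auto
    show "\<forall>y. \<bar>x - y\<bar> < min (x - p) (q - x) \<longrightarrow> g y \<le> g x"
      by (auto intro!: max)
  qed
  obtain d where d: "d > 0" "\<And>h. h > 0 \<Longrightarrow> h < d \<Longrightarrow> g' x < g' (x + h)"
    using DERIV_pos_inc_right[OF g' \<open>D > 0\<close>] by blast
  define y where "y = x + min d (q - x) / 2"
  have y: "x < y" "y < q" "y < x + d" using d(1) x by (auto simp: y_def min_def field_simps)
  obtain c where c: "x < c" "c < y" "g y - g x = (y - x) * g' c"
    using MVT2[OF y(1), of g g'] g x y by auto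
  have "g' c > 0" using d(2)[of "c - x"] c y \<open>g' x = 0\<close> by auto
  then have "g y > g x" using c y by (smt (verit) mult_pos_pos)
  with max[of y] x y show False by auto
qed

text \<open>A nondecreasing function tends to its infimum at the left end. The linear rate
  \<open>M * u\<close> is recorded because it depends on \<open>f\<close> only through the slope
  bound, which later makes the convergence uniform in time.\<close>

lemma bounded_slope_limit_at_0:
  fixes f f' :: "real \<Rightarrow> real"
  assumes f: "\<And>u. u \<in> {0<..<1} \<Longrightarrow> (f has_real_derivative f' u) (at u)"
    and f': "\<And>u. u \<in> {0<..<1} \<Longrightarrow> 0 \<le> f' u" "\<And>u. u \<in> {0<..<1} \<Longrightarrow> f' u \<le> M"
  obtains c where "(f \<longlongrightarrow> c) (at_right 0)"
    "\<And>u. u \<in> {0<..<1} \<Longrightarrow> c \<le> f u" "\<And>u. u \<in> {0<..<1} \<Longrightarrow> f u \<le> c + M * u"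
proof -
  have M: "0 \<le> M" using f'[of "1/2"] by auto
  have inc: "0 \<le> f v - f u \<and> f v - f u \<le> M * v" if "0 < u" "u \<le> v" "v < 1" for u v
  proof (cases "u = v")
    case False
    with that have "u < v" by simp
    moreover have "(f has_real_derivative f' x) (at x)" if "u \<le> x" "x \<le> v" for x
      using that \<open>0 < u\<close> \<open>v < 1\<close> by (intro f) auto
    ultimately obtain c where c: "u < c" "c < v" "f v - f u = (v - u) * f' c"
      using MVT2[of u v f f'] by blast
    have "(v - u) * f' c \<le> v * M" "0 \<le> (v - u) * f' c"
      using that c f'[of c] by (auto intro!: mult_mono)
    then show ?thesis using c by (simp add: mult.commute)
  qed (use that M in auto)
  define c where "c = Inf (f ` {0<..<1})"
  have bdd: "bdd_below (f ` {0<..<1})"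
  \<comment> \<open>Left of \<open>1/2\<close> the slope bound limits the descent by
    \<open>M\<close>; right of \<open>1/2\<close> monotonicity suffices.\<close>
  proof (rule bdd_belowI2)
    fix u :: real assume u: "u \<in> {0<..<1}"
    show "f (1/2) - M \<le> f u"
    proof (cases "u \<le> 1/2")
      case True
      then show ?thesis using inc[of u "1/2"] u M by auto
    next
      case False
      then show ?thesis using inc[of "1/2" u] u M by auto
    qed
  qed
  have lower: "c \<le> f u" if "u \<in> {0<..<1}" for u
    unfolding c_def using that by (intro cInf_lower bdd) auto
  have upper: "f u \<le> c + M * u" if u: "u \<in> {0<..<1}" for u
  proof -
    \<comment> \<open>\<open>f u - M * u\<close> lies below every value of \<open>f\<close>, hence
      below the infimum.\<close>
    have "f u - M * u \<le> c"
      unfolding c_def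
    proof (rule cInf_greatest)
      fix y assume "y \<in> f ` {0<..<1}"
      then obtain v where v: "v \<in> {0<..<1}" "y = f v" by auto
      show "f u - M * u \<le> y"
      proof (cases "u \<le> v")
        case True
        then have "f u \<le> f v" using inc[of u v] u v by auto
        moreover have "0 \<le> M * u" using M u by simp
        ultimately show ?thesis using v by simp
      next
        case False
        then show ?thesis using inc[of v u] u v by auto
      qed
    qed auto
    then show ?thesis by simp
  qed
  have "(f \<longlongrightarrow> c) (at_right 0)"
  proof (rule tendsto_sandwich)
    have ev: "\<forall>\<^sub>F u::real in at_right 0. u \<in> {0<..<1}"
      by (auto simp: eventually_at_right_field intro: exI[of _ 1])
    show "\<forall>\<^sub>F u in at_right 0. c \<le> f u" using ev by eventually_elim (rule lower)
    show "\<forall>\<^sub>F u in at_right 0. f u \<le> c + M * u" using ev by eventually_elim (rule upper)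
    show "((\<lambda>u. c + M * u) \<longlongrightarrow> c) (at_right 0)"
      by (auto intro!: tendsto_eq_intros)
  qed auto
  with lower upper that show thesis by blast
qed

lemma uniform_boundary_limit_continuous:
  fixes f :: "real \<Rightarrow> real \<Rightarrow> real"
  assumes cont: "\<And>u. u \<in> {0<..<1} \<Longrightarrow> continuous_on A (f u)"
    and close: "\<And>u t. u \<in> {0<..<1} \<Longrightarrow> t \<in> A \<Longrightarrow> \<bar>f u t - c t\<bar> \<le> M * u"
  shows "continuous_on A c"
proof (rule uniform_limit_theorem)
  show "\<forall>\<^sub>F u in at_right 0. continuous_on A (f u)"
    using cont by (auto simp: eventually_at_right_field intro: exI[of _ 1])
  show "uniform_limit A f c (at_right 0)"
  proof (rule uniform_limitI)
    fix e :: real assume e: "0 < e"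
    \<comment> \<open>\<open>M\<close> may have either sign; \<open>\<bar>M\<bar> + 1\<close> keeps
      the denominator positive.\<close>
    define d where "d = min 1 (e / (\<bar>M\<bar> + 1))"
    have d: "0 < d" "d \<le> 1" "d \<le> e / (\<bar>M\<bar> + 1)" using e by (auto simp: d_def)
    have "dist (f u t) (c t) < e" if u: "0 < u" "u < d" and t: "t \<in> A" for u t
    proof -
      have "M * u \<le> \<bar>M\<bar> * u" using u by (intro mult_right_mono) auto
      also have "\<dots> < (\<bar>M\<bar> + 1) * u" using u by simp
      also have "\<dots> \<le> (\<bar>M\<bar> + 1) * (e / (\<bar>M\<bar> + 1))" using u d by (intro mult_left_mono) auto
      also have "\<dots> = e" by (simp add: add_nonneg_eq_0_iff)
      finally show ?thesis using close[of u t] u d t by (auto simp: dist_real_def)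
    qed
    then show "\<forall>\<^sub>F u in at_right 0. \<forall>t\<in>A. dist (f u t) (c t) < e"
      using d(1) by (auto simp: eventually_at_right_field)
  qed
qed simp

text \<open>The reflection \<open>1 - u\<close> carries statements about the end
  \<open>u = 0\<close> over to \<open>u = 1\<close>.\<close>

lemma filterlim_reflect_at_left: "filterlim (\<lambda>u::real. 1 - u) (at_right 0) (at_left 1)"
  unfolding filterlim_at
  by (auto simp: eventually_at_left_field intro!: tendsto_eq_intros exI[of _ 0])

lemma filterlim_reflect_at_right: "filterlim (\<lambda>u::real. 1 - u) (at_left 1) (at_right 0)"
  unfolding filterlim_at
  by (auto simp: eventually_at_right_field intro!: tendsto_eq_intros exI[of _ 1])

text \<open>The partial derivative in the second variable is the Frechet derivative in direction
  \<open>(0, 1)\<close>, and the first level of \<open>Ck_on\<close> already makes it continuous.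
  This continuity is what differentiation under the integral requires.\<close>

lemma smooth_on_partial_derivative:
  fixes z :: "real \<Rightarrow> real \<Rightarrow> real"
  assumes "smooth_on S (\<lambda>(u, t). z u t)"
  obtains q where "continuous_on S (\<lambda>(u, t). q u t)"
    "\<And>u t. (u, t) \<in> S \<Longrightarrow> (z u has_real_derivative q u t) (at t)"
proof -
  let ?F = "\<lambda>(u, t). z u t"
  define q where "q u t = frechet_derivative ?F (at (u, t)) (0, 1)" for u t
  have "Ck_on (Suc 0) S ?F" using assms unfolding smooth_on_def by blast
  then have diff: "\<And>x. x \<in> S \<Longrightarrow> ?F differentiable (at x)"
    and cont: "continuous_on S (\<lambda>x. frechet_derivative ?F (at x) (0, 1))"
    by auto
  show thesis
  proof (rule that)
    show "continuous_on S (\<lambda>(u, t). q u t)"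
      using cont by (simp add: q_def case_prod_unfold)
    fix u t assume ut: "(u, t) \<in> S"
    let ?D = "frechet_derivative ?F (at (u, t))"
    have D: "(?F has_derivative ?D) (at (u, t))"
      using diff[OF ut] by (simp add: frechet_derivative_works)
    have "((\<lambda>s. (u, s)) has_derivative (\<lambda>h. (0, h))) (at t)"
      by (intro derivative_intros)
    from has_derivative_compose[OF this D]
    have "(z u has_derivative (\<lambda>h. ?D (0, h))) (at t)" by simp
    moreover have "?D (0, h) = q u t * h" for h
    proof -
      have "?D (h *\<^sub>R (0, 1)) = h *\<^sub>R ?D (0, 1)"
        by (rule linear_scale[OF has_derivative_linear[OF D]])
      then show ?thesis by (simp add: q_def mult.commute)
    qed
    ultimately show "(z u has_real_derivative q u t) (at t)"
      by (simp add: has_field_derivative_def)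
  qed
qed

text \<open>\<open>Ck_on\<close> speaks of Frechet derivatives in a direction. In direction
  \<open>1\<close> these agree with \<open>deriv\<close> on the open set \<open>S\<close>, so the
  second derivative carries over.\<close>

lemma smooth_on_real_deriv2:
  fixes f :: "real \<Rightarrow> real"
  assumes f: "smooth_on S f" and S: "open S" and x: "x \<in> S"
  shows "(f has_real_derivative deriv f x) (at x)"
    and "(deriv f has_real_derivative deriv (deriv f) x) (at x)"
proof -
  have "Ck_on (Suc (Suc 0)) S f" using f unfolding smooth_on_def by blast
  then have diff: "\<And>y. y \<in> S \<Longrightarrow> f differentiable (at y)"
    and diff2: "\<And>y. y \<in> S \<Longrightarrow> (\<lambda>y. frechet_derivative f (at y) 1) differentiable (at y)"
    by auto
  have D: "(f has_real_derivative deriv f y) (at y)" if "y \<in> S" for y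
    using diff[OF that] by (simp add: DERIV_deriv_iff_real_differentiable)
  then show "(f has_real_derivative deriv f x) (at x)" using x .
  have eq: "frechet_derivative f (at y) 1 = deriv f y" if "y \<in> S" for y
  proof -
    have "(f has_derivative (*) (deriv f y)) (at y)"
      using D[OF that] by (simp add: has_field_derivative_def)
    from frechet_derivative_at[OF this] have "frechet_derivative f (at y) = (*) (deriv f y)" ..
    then show ?thesis by simp
  qed
  obtain E where "((\<lambda>y. frechet_derivative f (at y) 1) has_real_derivative E) (at x)"
    using diff2[OF x] by (auto simp: real_differentiable_def)
  then have "(deriv f has_real_derivative E) (at x)"
    by (rule has_field_derivative_transform_within_open[OF _ S x eq])
  then show "(deriv f has_real_derivative deriv (deriv f) x) (at x)"
    using DERIV_imp_deriv by fastforce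
qed

text \<open>Integrating \<open>z\<^sub>t = p\<^sub>u\<close> over \<open>\<alpha> < u < h\<close> and letting \<open>\<alpha> \<rightarrow> 0\<close> leaves
  \<open>p(h, t) \<ge> 0\<close> as the time derivative of the integral of \<open>z\<close> over \<open>(0, h)\<close>; the limit at
  \<open>u = 0\<close> is recovered from \<open>h \<rightarrow> 0\<close>.\<close>

lemma potential_limit_mono:
  fixes z p q :: "real \<Rightarrow> real \<Rightarrow> real"
  assumes zt: "\<And>u t. u \<in> {0<..<1} \<Longrightarrow> t \<in> I \<Longrightarrow> (z u has_real_derivative q u t) (at t)"
    and pu: "\<And>u t. u \<in> {0<..<1} \<Longrightarrow> t \<in> I \<Longrightarrow> ((\<lambda>v. p v t) has_real_derivative q u t) (at u)"
    and q: "continuous_on ({0<..<1} \<times> I) (\<lambda>(u, t). q u t)"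
    and z: "\<And>t. t \<in> I \<Longrightarrow> continuous_on {0<..<1} (\<lambda>u. z u t)"
    and p: "\<And>u t. u \<in> {0<..<1} \<Longrightarrow> t \<in> I \<Longrightarrow> 0 \<le> p u t"
    and p0: "\<And>e. 0 < e \<Longrightarrow> \<exists>d>0. \<forall>u\<in>{0<..<d}. \<forall>t\<in>{t1..t2}. p u t \<le> e"
    and I: "open I" "convex I" "t1 \<in> I" "t2 \<in> I" "t1 < t2"
    and l1: "((\<lambda>u. z u t1) \<longlongrightarrow> l1) (at_right 0)" and l2: "((\<lambda>u. z u t2) \<longlongrightarrow> l2) (at_right 0)"
  shows "l1 \<le> l2"
proof (rule ccontr)
  assume "\<not> l1 \<le> l2"
  then have c: "0 < (l1 - l2) / 2" "(l1 - l2) / 2 < l1 - l2" by auto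
  define c where "c = (l1 - l2) / 2"
  have sub: "{t1..t2} \<subseteq> I"
    using I closed_segment_subset[of t1 I t2] by (simp add: closed_segment_eq_real_ivl)
  have "((\<lambda>u. z u t1 - z u t2) \<longlongrightarrow> l1 - l2) (at_right 0)"
    by (intro tendsto_intros l1 l2)
  then have "\<forall>\<^sub>F u in at_right 0. c < z u t1 - z u t2"
    using c(2) unfolding c_def by (rule order_tendstoD(1))
  then obtain b where b: "0 < b" "\<And>u. 0 < u \<Longrightarrow> u < b \<Longrightarrow> c < z u t1 - z u t2"
    by (auto simp: eventually_at_right_field)
  define h where "h = min b 1 / 2"
  have h: "0 < h" "h < b" "h < 1" using b by (auto simp: h_def)
  \<comment> \<open>Flow through \<open>\<alpha>\<close> during \<open>[t1, t2]\<close> can lower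
    the integral of \<open>z\<close> over \<open>(\<alpha>, h)\<close> by at most
    \<open>h * c / 4\<close>, while the assumed gap lowers it by at least \<open>h * c / 2\<close>,
    because \<open>\<alpha> \<le> h / 2\<close>.\<close>
  define e where "e = h * c / (4 * (t2 - t1))"
  have e: "0 < e" using h c I by (simp add: e_def c_def)
  have e_time: "(t2 - t1) * e = h * c / 4" using I(5) by (simp add: e_def field_simps)
  obtain d where d: "0 < d" "\<And>u t. 0 < u \<Longrightarrow> u < d \<Longrightarrow> t \<in> {t1..t2} \<Longrightarrow> p u t \<le> e"
    using p0[OF e] by auto
  define \<alpha> where "\<alpha> = min d h / 2"
  have \<alpha>: "0 < \<alpha>" "\<alpha> < d" "\<alpha> \<le> h / 2" using d h by (auto simp: \<alpha>_def)
  have "\<alpha> < h" using \<alpha>(3) h(1) by simp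
  have in01: "{\<alpha>..h} \<subseteq> {0<..<1}" using \<alpha> h by auto
  have zint: "(\<lambda>u. z u t) integrable_on {\<alpha>..h}" if "t \<in> I" for t
    by (rule integrable_continuous_real, rule continuous_on_subset[OF z[OF that] in01])
  define G where "G t = integral {\<alpha>..h} (\<lambda>u. z u t)" for t
  have G': "(G has_real_derivative (p h t - p \<alpha> t)) (at t)" if t: "t \<in> I" for t
  proof -
    have "((\<lambda>u. q u t) has_integral (p h t - p \<alpha> t)) {\<alpha>..h}"
      using \<open>\<alpha> < h\<close> t in01
      by (intro has_integral_DERIV[where f="\<lambda>u. p u t"] pu) auto
    moreover have "(G has_real_derivative integral {\<alpha>..h} (\<lambda>u. q u t)) (at t)"
      unfolding G_def
    proof (rule DERIV_integral_parameter)
      show "continuous_on ({\<alpha>..h} \<times> I) (\<lambda>(u, s). q u s)"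
        by (rule continuous_on_subset[OF q]) (use in01 in auto)
      show "continuous_on {\<alpha>..h} (\<lambda>u. z u s)" if "s \<in> I" for s
        by (rule continuous_on_subset[OF z[OF that] in01])
      show "(z u has_real_derivative q u s) (at s)" if "u \<in> {\<alpha>..h}" "s \<in> I" for u s
        using that in01 by (intro zt) auto
    qed (use t I in auto)
    ultimately show ?thesis by (simp add: integral_unique)
  qed
  obtain s where s: "t1 < s" "s < t2" "G t2 - G t1 = (t2 - t1) * (p h s - p \<alpha> s)"
    using MVT2[OF I(5), of G "\<lambda>t. p h t - p \<alpha> t"] G' sub by (auto simp: subset_iff)
  have "s \<in> {t1..t2}" using s by auto
  \<comment> \<open>The term at \<open>h\<close> is only known to be nonnegative and is dropped; the
    term at \<open>\<alpha>\<close> is at most \<open>e\<close>.\<close>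
  then have "- e \<le> p h s - p \<alpha> s"
    using p[of h s] d(2)[of \<alpha> s] sub h \<alpha> by auto
  then have 1: "- (h * c / 4) \<le> G t2 - G t1"
    using mult_left_mono[of "-e" "p h s - p \<alpha> s" "t2 - t1"] s I e_time by simp
  have "(h - \<alpha>) * c \<le> G t1 - G t2"
  proof -
    have "integral {\<alpha>..h} (\<lambda>u. c) \<le> integral {\<alpha>..h} (\<lambda>u. z u t1 - z u t2)"
      using b(2) \<alpha> h by (intro integral_le integrable_diff zint I) (auto intro: less_imp_le)
    then show ?thesis
      using \<open>\<alpha> < h\<close> by (simp add: G_def Henstock_Kurzweil_Integration.integral_diff zint I)
  qed
  moreover have "h / 2 * c \<le> (h - \<alpha>) * c"
    using \<alpha> c by (intro mult_right_mono) (auto simp: c_def)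
  moreover have "0 < h * c" using h c by (simp add: c_def)
  ultimately show False using 1 by simp
qed

subsection \<open>The conjugate flux and the initial potential\<close>

text \<open>Derivatives of the conjugate flux come from the chain rule at \<open>1 / s\<close> and
  are claimed for \<open>s > 0\<close> only. At \<open>0\<close> there remains right continuity,
  since \<open>1 / s\<close> tends to infinity, and strict monotonicity there amounts to
  \<open>\<Phi> < L\<close>.\<close>

lemma
  fixes \<Phi> :: "real \<Rightarrow> real"
  assumes smooth: "smooth_on {0<..} \<Phi>" and pos: "\<And>s. 0 < s \<Longrightarrow> 0 < deriv \<Phi> s"
    and lim: "(\<Phi> \<longlongrightarrow> L) at_top"
  shows conj_flux_strict_mono: "strict_mono_on {0..} (conj_flux \<Phi> L)"
    and conj_flux_at_0: "(conj_flux \<Phi> L \<longlongrightarrow> conj_flux \<Phi> L 0) (at_right 0)"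
    and conj_flux_deriv: "0 < s \<Longrightarrow> (conj_flux \<Phi> L has_real_derivative deriv \<Phi> (1 / s) / s\<^sup>2) (at s)"
    and conj_flux_deriv2: "0 < s \<Longrightarrow> ((\<lambda>s. deriv \<Phi> (1 / s) / s\<^sup>2) has_real_derivative
          deriv (\<lambda>s. deriv \<Phi> (1 / s) / s\<^sup>2) s) (at s)"
proof -
  have D: "(\<Phi> has_real_derivative deriv \<Phi> s) (at s)"
      "(deriv \<Phi> has_real_derivative deriv (deriv \<Phi>) s) (at s)" if "0 < s" for s
    using smooth_on_real_deriv2[OF smooth _, of s] that by auto
  have mono: "\<Phi> s < \<Phi> t" if "0 < s" "s < t" for s t
  proof (rule DERIV_pos_imp_increasing[OF that(2)])
    fix x assume "s \<le> x" "x \<le> t"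
    then have "0 < x" using that by simp
    then show "\<exists>y. (\<Phi> has_real_derivative y) (at x) \<and> 0 < y" using D(1) pos by blast
  qed
  have below: "\<Phi> s < L" if s: "0 < s" for s
  proof -
    \<comment> \<open>Passing to the limit preserves only weak inequalities; strictness comes from
      the intermediate value at \<open>s + 1\<close>.\<close>
    have "\<Phi> (s + 1) \<le> L"
    proof (rule tendsto_lowerbound[OF lim])
      show "\<forall>\<^sub>F x in at_top. \<Phi> (s + 1) \<le> \<Phi> x"
        using eventually_ge_at_top[of "s + 1"]
      proof eventually_elim
        case (elim x)
        then show ?case using mono[of "s + 1" x] s by (cases "x = s + 1") auto
      qed
    qed simp
    with mono[of s "s + 1"] s show ?thesis by simp
  qed
  show "strict_mono_on {0..} (conj_flux \<Phi> L)"
  proof (rule strict_mono_onI)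
    fix s t :: real assume st: "s \<in> {0..}" "t \<in> {0..}" "s < t"
    show "conj_flux \<Phi> L s < conj_flux \<Phi> L t"
    proof (cases "s = 0")
      case True
      then show ?thesis using below[of "1 / t"] st by (simp add: conj_flux_def)
    next
      case False
      then have "1 / t < 1 / s" using st by (simp add: field_simps)
      then show ?thesis using mono[of "1 / t" "1 / s"] st False by (simp add: conj_flux_def)
    qed
  qed
  have "((\<lambda>s. - \<Phi> (inverse s)) \<longlongrightarrow> - L) (at_right 0)"
    by (intro tendsto_minus filterlim_compose[OF lim filterlim_inverse_at_top_right])
  then have "(conj_flux \<Phi> L \<longlongrightarrow> - L) (at_right 0)"
  proof (rule Lim_transform_eventually)
    show "\<forall>\<^sub>F s in at_right 0. - \<Phi> (inverse s) = conj_flux \<Phi> L s"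
      by (auto simp: eventually_at_right_field conj_flux_def inverse_eq_divide intro: exI[of _ 1])
  qed
  then show "(conj_flux \<Phi> L \<longlongrightarrow> conj_flux \<Phi> L 0) (at_right 0)"
    by (simp add: conj_flux_def)
  show "(conj_flux \<Phi> L has_real_derivative deriv \<Phi> (1 / s) / s\<^sup>2) (at s)" if s: "0 < s" for s
  proof (rule has_field_derivative_transform_within_open)
    have inv: "((\<lambda>s. 1 / s) has_real_derivative - (1 / s\<^sup>2)) (at s)"
      using s by (auto intro!: derivative_eq_intros simp: power2_eq_square)
    have "((\<lambda>s. \<Phi> (1 / s)) has_real_derivative deriv \<Phi> (1 / s) * - (1 / s\<^sup>2)) (at s)"
      using s by (intro DERIV_chain2[where f=\<Phi> and g="\<lambda>s. 1 / s", OF D(1) inv]) simp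
    from DERIV_minus[OF this]
    show "((\<lambda>s. - \<Phi> (1 / s)) has_real_derivative deriv \<Phi> (1 / s) / s\<^sup>2) (at s)" by simp
    show "- \<Phi> (1 / t) = conj_flux \<Phi> L t" if "t \<in> {0<..}" for t
      using that by (simp add: conj_flux_def)
  qed (use s in auto)
  show "((\<lambda>s. deriv \<Phi> (1 / s) / s\<^sup>2) has_real_derivative
          deriv (\<lambda>s. deriv \<Phi> (1 / s) / s\<^sup>2) s) (at s)" if s: "0 < s" for s
  proof -
    have inv: "((\<lambda>s. 1 / s) has_real_derivative - (1 / s\<^sup>2)) (at s)"
      using s by (auto intro!: derivative_eq_intros simp: power2_eq_square)
    have "((\<lambda>s. deriv \<Phi> (1 / s)) has_real_derivative deriv (deriv \<Phi>) (1 / s) * - (1 / s\<^sup>2)) (at s)"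
      using s by (intro DERIV_chain2[where f="deriv \<Phi>" and g="\<lambda>s. 1 / s", OF D(2) inv]) simp
    moreover have "((\<lambda>s. s\<^sup>2) has_real_derivative 2 * s) (at s)"
      by (auto intro!: derivative_eq_intros)
    ultimately have "(\<lambda>s. deriv \<Phi> (1 / s) / s\<^sup>2) differentiable (at s)"
      using DERIV_divide[of "\<lambda>s. deriv \<Phi> (1 / s)" _ s UNIV "\<lambda>s. s\<^sup>2"] s
      by (auto simp: real_differentiable_def)
    then show ?thesis by (simp add: DERIV_deriv_iff_real_differentiable)
  qed
qed

text \<open>By the chain rule \<open>f (u0 x)\<close> has derivative \<open>1\<close>, so
  \<open>f (u0 x) - x\<close> is the constant \<open>- x0\<close>, and \<open>x0 + f\<close> inverts
  \<open>u0\<close>. Composing with \<open>u0\<close> avoids differentiating an inverse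
  function.\<close>

lemma inverse_function_potential:
  fixes u0 f f' :: "real \<Rightarrow> real"
  assumes u0: "continuous_on {a..b} u0" "strict_mono_on {a..b} u0" "u0 a = 0" "u0 b = 1" "a < b"
    and diff: "\<And>x. x \<in> {a<..<b} \<Longrightarrow> u0 differentiable (at x)"
    and nz: "\<And>x. x \<in> {a<..<b} \<Longrightarrow> deriv u0 x \<noteq> 0"
    and f: "\<And>u. u \<in> {0<..<1} \<Longrightarrow> (f has_real_derivative conj_init a b u0 u) (at u)"
    and x0: "x0 \<in> {a<..<b}" "f (u0 x0) = 0"
    and u: "u \<in> {0<..<1}"
  shows "x0 + f u \<in> {a<..<b}"
proof -
  have inj: "inj_on u0 {a..b}" using u0(2) by (rule strict_mono_on_imp_inj_on)
  have range: "u0 x \<in> {0<..<1}" if "x \<in> {a<..<b}" for x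
    using strict_mono_onD[OF u0(2), of a x] strict_mono_onD[OF u0(2), of x b] that u0 by auto
  have "((\<lambda>x. f (u0 x) - x) has_real_derivative 0) (at x)" if x: "x \<in> {a<..<b}" for x
  proof -
    have "the_inv_into {a..b} u0 (u0 x) = x" using x by (intro the_inv_into_f_f inj) auto
    then have init: "conj_init a b u0 (u0 x) = 1 / deriv u0 x" by (simp add: conj_init_def)
    have "(u0 has_real_derivative deriv u0 x) (at x)"
      using diff[OF x] by (simp add: DERIV_deriv_iff_real_differentiable)
    from DERIV_chain2[where f=f and g=u0, OF f[OF range[OF x]] this]
    have "((\<lambda>x. f (u0 x)) has_real_derivative 1) (at x)" using nz[OF x] by (simp add: init)
    from DERIV_diff[OF this DERIV_ident] show ?thesis by simp
  qed
  then have "\<exists>c. \<forall>x\<in>{a<..<b}. f (u0 x) - x = c"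
    by (intro has_field_derivative_zero_constant[OF convex_real_interval(8)]
        has_field_derivative_at_within[where s="{a<..<b}"])
  then obtain c where c: "\<And>x. x \<in> {a<..<b} \<Longrightarrow> f (u0 x) - x = c" by blast
  obtain x where x: "a \<le> x" "x \<le> b" "u0 x = u"
    using IVT'[of u0 a u b] u0 u by auto
  then have "x \<noteq> a" "x \<noteq> b" using u u0 by auto
  with x have x': "x \<in> {a<..<b}" by auto
  show ?thesis using c[OF x'] c[OF x0(1)] x x0 x' by (auto simp: algebra_simps)
qed

subsection \<open>The approximating solutions\<close>

text \<open>The estimates are made for the classical solutions \<open>W \<epsilon>\<close> and reach
  \<open>w\<close>, here just a pointwise limit, through \<open>w \<le> W \<epsilon>\<close>. As
  \<open>W\<close> increases with \<open>\<epsilon>\<close>, a bound for \<open>W 1\<close> can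
  serve as \<open>M\<close>, whence the restriction \<open>\<epsilon> \<le> 1\<close>.\<close>

locale conjugate_limit =
  fixes \<Psi> \<Psi>' \<Psi>'' w0 :: "real \<Rightarrow> real" and W :: "real \<Rightarrow> real \<Rightarrow> real \<Rightarrow> real"
    and w :: "real \<Rightarrow> real \<Rightarrow> real" and M :: real
  assumes flux_strict_mono: "strict_mono_on {0..} \<Psi>"
    and flux_at_0: "(\<Psi> \<longlongrightarrow> \<Psi> 0) (at_right 0)"
    and flux_deriv: "\<And>s. 0 < s \<Longrightarrow> (\<Psi> has_real_derivative \<Psi>' s) (at s)"
    and flux_deriv2: "\<And>s. 0 < s \<Longrightarrow> (\<Psi>' has_real_derivative \<Psi>'' s) (at s)"
    and W_solution: "\<And>\<epsilon>. 0 < \<epsilon> \<Longrightarrow> classical_solution \<Psi> w0 \<epsilon> (W \<epsilon>)"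
    and W_mono: "\<And>u t. (u, t) \<in> par_dom \<Longrightarrow> mono_on {0<..} (\<lambda>\<epsilon>. W \<epsilon> u t)"
    and W_lim: "\<And>u t. (u, t) \<in> par_dom \<Longrightarrow> ((\<lambda>\<epsilon>. W \<epsilon> u t) \<longlongrightarrow> w u t) (at_right 0)"
    and W_le: "\<And>\<epsilon> u t. 0 < \<epsilon> \<Longrightarrow> \<epsilon> \<le> 1 \<Longrightarrow> (u, t) \<in> par_dom \<Longrightarrow> W \<epsilon> u t \<le> M"
begin

lemma flux_mono: "0 \<le> x \<Longrightarrow> x \<le> y \<Longrightarrow> \<Psi> x \<le> \<Psi> y"
  using strict_mono_on_leD[OF flux_strict_mono, of x y] by auto

lemma flux_strict: "0 \<le> x \<Longrightarrow> x < y \<Longrightarrow> \<Psi> x < \<Psi> y"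
  using strict_mono_onD[OF flux_strict_mono, of x y] by auto

lemma par_domI [simp]:
  "u \<in> {0<..<1} \<Longrightarrow> 0 \<le> t \<Longrightarrow> (u, t) \<in> par_dom"
  "u \<in> {0..1} \<Longrightarrow> 0 < t \<Longrightarrow> (u, t) \<in> par_dom"
  by (auto simp: par_dom_def)

lemma W_ge: "0 < \<epsilon> \<Longrightarrow> (u, t) \<in> par_dom \<Longrightarrow> \<epsilon> \<le> W \<epsilon> u t"
  using W_solution[of \<epsilon>] by (auto simp: classical_solution_def)

lemma W_boundary: "0 < \<epsilon> \<Longrightarrow> 0 < t \<Longrightarrow> W \<epsilon> 0 t = \<epsilon>" "0 < \<epsilon> \<Longrightarrow> 0 < t \<Longrightarrow> W \<epsilon> 1 t = \<epsilon>"
  using W_solution[of \<epsilon>] by (auto simp: classical_solution_def)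

lemma W_initial: "0 < \<epsilon> \<Longrightarrow> u \<in> {0<..<1} \<Longrightarrow> W \<epsilon> u 0 = w0 u + \<epsilon>"
  using W_solution[of \<epsilon>] by (auto simp: classical_solution_def)

lemma W_continuous: "0 < \<epsilon> \<Longrightarrow> continuous_on par_dom (\<lambda>(u, t). W \<epsilon> u t)"
  using W_solution[of \<epsilon>] by (auto simp: classical_solution_def)

lemma W_continuous_space:
  assumes "0 < \<epsilon>" "0 < t" shows "continuous_on {0..1} (\<lambda>u. W \<epsilon> u t)"
proof -
  have "continuous_on {0..1} (\<lambda>u. case (u, t) of (u, t) \<Rightarrow> W \<epsilon> u t)"
    by (rule continuous_on_compose2[OF W_continuous[OF assms(1)]])
       (use assms in \<open>auto intro!: continuous_intros\<close>)
  then show ?thesis by simp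
qed

lemma w_le_W:
  assumes "0 < \<epsilon>" "(u, t) \<in> par_dom" shows "w u t \<le> W \<epsilon> u t"
proof (rule tendsto_upperbound[OF W_lim[OF assms(2)]])
  have "W x u t \<le> W \<epsilon> u t" if "0 < x" "x < \<epsilon>" for x
    using mono_onD[OF W_mono[OF assms(2)], of x \<epsilon>] that by auto
  then show "\<forall>\<^sub>F x in at_right 0. W x u t \<le> W \<epsilon> u t"
    using assms(1) by (auto simp: eventually_at_right_field)
qed simp

lemma w_nonneg:
  assumes "(u, t) \<in> par_dom" shows "0 \<le> w u t"
proof (rule tendsto_lowerbound[OF W_lim[OF assms]])
  have "0 \<le> W x u t" if "0 < x" for x using W_ge[OF that assms] that by simp
  then show "\<forall>\<^sub>F x in at_right 0. 0 \<le> W x u t"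
    by (auto simp: eventually_at_right_field intro: exI[of _ 1])
qed simp

lemma w_le: "(u, t) \<in> par_dom \<Longrightarrow> w u t \<le> M"
  using w_le_W[of 1 u t] W_le[of 1 u t] by auto

lemma w_initial:
  assumes u: "u \<in> {0<..<1}" shows "w u 0 = w0 u"
proof (rule tendsto_unique)
  show "((\<lambda>\<epsilon>. W \<epsilon> u 0) \<longlongrightarrow> w u 0) (at_right 0)" using u by (intro W_lim) auto
  have "((\<lambda>\<epsilon>. w0 u + \<epsilon>) \<longlongrightarrow> w0 u) (at_right 0)" by (auto intro!: tendsto_eq_intros)
  then show "((\<lambda>\<epsilon>. W \<epsilon> u 0) \<longlongrightarrow> w0 u) (at_right 0)"
  proof (rule Lim_transform_eventually)
    show "\<forall>\<^sub>F \<epsilon> in at_right 0. w0 u + \<epsilon> = W \<epsilon> u 0"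
      using u by (auto simp: eventually_at_right_field W_initial intro: exI[of _ 1])
  qed
qed simp

lemma w_boundary:
  assumes t: "0 < t" shows "w 0 t = 0" "w 1 t = 0"
proof -
  have *: "w v t = 0" if v: "v = 0 \<or> v = 1" for v
  proof (rule antisym)
    have dom: "(v, t) \<in> par_dom" using v t by auto
    show "0 \<le> w v t" using dom by (rule w_nonneg)
    have "w v t \<le> 0 + \<epsilon>" if "0 < \<epsilon>" for \<epsilon>
      using w_le_W[OF that dom] W_boundary[OF that t] v by auto
    then show "w v t \<le> 0" by (rule field_le_epsilon)
  qed
  show "w 0 t = 0" "w 1 t = 0" by (simp_all add: *)
qed

text \<open>\<open>W \<epsilon>\<close> equals \<open>\<epsilon>\<close> on the lateral boundary and
  is uniformly continuous on the compact set \<open>{0..1} \<times> {t1..t2}\<close>. The condition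
  \<open>0 < t1\<close> keeps this set away from the corners missing in
  \<open>par_dom\<close>.\<close>

lemma W_near_boundary:
  assumes \<epsilon>: "0 < \<epsilon>" and t1: "0 < t1" and \<eta>: "0 < \<eta>"
  obtains d where "0 < d"
    "\<And>u t. t \<in> {t1..t2} \<Longrightarrow> u \<in> {0..1} \<Longrightarrow> u < d \<or> 1 - d < u \<Longrightarrow> W \<epsilon> u t \<le> \<epsilon> + \<eta>"
proof -
  let ?K = "{0..1::real} \<times> {t1..t2}" and ?f = "\<lambda>(u, t). W \<epsilon> u t"
  have sub: "?K \<subseteq> par_dom" using t1 by (auto simp: par_dom_def)
  have "uniformly_continuous_on ?K ?f"
    by (intro compact_uniformly_continuous continuous_on_subset[OF W_continuous[OF \<epsilon>] sub]
        compact_Times compact_Icc)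
  then obtain d where d: "0 < d" "\<And>x y. x \<in> ?K \<Longrightarrow> y \<in> ?K \<Longrightarrow> dist y x < d \<Longrightarrow> dist (?f y) (?f x) < \<eta>"
    using \<eta> unfolding uniformly_continuous_on_def by metis
  show thesis
  proof (rule that[OF d(1)])
    fix u t assume t: "t \<in> {t1..t2}" and u: "u \<in> {0..1}" and near: "u < d \<or> 1 - d < u"
    define v :: real where "v = (if u < d then 0 else 1)"
    have v: "v = 0 \<or> v = 1" "\<bar>u - v\<bar> < d" using u near by (auto simp: v_def)
    then have "dist (W \<epsilon> u t) (W \<epsilon> v t) < \<eta>"
      using d(2)[of "(v, t)" "(u, t)"] t u by (auto simp: dist_Pair_Pair dist_real_def)
    moreover have "W \<epsilon> v t = \<epsilon>" using W_boundary[OF \<epsilon>, of t] v t t1 by auto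
    ultimately show "W \<epsilon> u t \<le> \<epsilon> + \<eta>" by (simp add: dist_real_def)
  qed
qed

text \<open>The equation is put into first-order form with explicit derivatives: \<open>Pu\<close>
  is the space derivative of the flux, and its own space derivative is the time derivative of
  \<open>W \<epsilon>\<close>. The bound \<open>W \<epsilon> \<ge> \<epsilon>\<close> keeps the
  argument of \<open>\<Psi>\<close> positive, where the chain rule applies.\<close>

lemma W_equation:
  assumes \<epsilon>: "0 < \<epsilon>"
  obtains Wt Pu :: "real \<Rightarrow> real \<Rightarrow> real"
  where "continuous_on ({0<..<1} \<times> {0<..}) (\<lambda>(u, t). Wt u t)"
    "\<And>u t. u \<in> {0<..<1} \<Longrightarrow> 0 < t \<Longrightarrow> (W \<epsilon> u has_real_derivative Wt u t) (at t)"
    "\<And>u t. u \<in> {0<..<1} \<Longrightarrow> 0 < t \<Longrightarrow> ((\<lambda>v. \<Psi> (W \<epsilon> v t)) has_real_derivative Pu u t) (at u)"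
    "\<And>u t. u \<in> {0<..<1} \<Longrightarrow> 0 < t \<Longrightarrow> ((\<lambda>v. Pu v t) has_real_derivative Wt u t) (at u)"
proof -
  have "C21_on ({0<..<1} \<times> {0<..}) (W \<epsilon>)"
    and eq: "\<And>u t. u \<in> {0<..<1} \<Longrightarrow> 0 < t \<Longrightarrow>
           deriv (W \<epsilon> u) t = deriv (deriv (\<lambda>v. \<Psi> (W \<epsilon> v t))) u"
    using W_solution[OF \<epsilon>] by (simp_all add: classical_solution_def)
  then obtain fu fuu ft where
    ft: "continuous_on ({0<..<1} \<times> {0<..}) (\<lambda>(u, t). ft u t)" and
    C21: "\<forall>(u, t)\<in>{0<..<1} \<times> {0<..}.
           ((\<lambda>v. W \<epsilon> v t) has_real_derivative fu u t) (at u) \<and>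
           ((\<lambda>v. fu v t) has_real_derivative fuu u t) (at u) \<and>
           (W \<epsilon> u has_real_derivative ft u t) (at t)"
    unfolding C21_on_def by blast
  have D: "((\<lambda>v. W \<epsilon> v t) has_real_derivative fu u t) (at u)"
      "((\<lambda>v. fu v t) has_real_derivative fuu u t) (at u)"
      "(W \<epsilon> u has_real_derivative ft u t) (at t)" if "u \<in> {0<..<1}" "0 < t" for u t
    using C21 that by auto
  define Pu where "Pu u t = \<Psi>' (W \<epsilon> u t) * fu u t" for u t
  have pos: "0 < W \<epsilon> u t" if "u \<in> {0<..<1}" "0 < t" for u t
    using W_ge[OF \<epsilon>, of u t] that \<epsilon> by auto
  have P1: "((\<lambda>v. \<Psi> (W \<epsilon> v t)) has_real_derivative Pu u t) (at u)" if "u \<in> {0<..<1}" "0 < t" for u t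
    unfolding Pu_def using D[OF that] pos[OF that] by (intro DERIV_chain2 flux_deriv) auto
  have P2: "((\<lambda>v. Pu v t) has_real_derivative ft u t) (at u)" if ut: "u \<in> {0<..<1}" "0 < t" for u t
  proof -
    have "((\<lambda>v. \<Psi>' (W \<epsilon> v t)) has_real_derivative \<Psi>'' (W \<epsilon> u t) * fu u t) (at u)"
      using D[OF ut] pos[OF ut] by (intro DERIV_chain2 flux_deriv2) auto
    then obtain E where E: "((\<lambda>v. Pu v t) has_real_derivative E) (at u)"
      unfolding Pu_def using DERIV_mult[OF _ D(2)[OF ut]] by blast
    have "(deriv (\<lambda>v. \<Psi> (W \<epsilon> v t)) has_real_derivative E) (at u)"
    proof (rule has_field_derivative_transform_within_open[OF E, of "{0<..<1}"])
      show "Pu v t = deriv (\<lambda>v. \<Psi> (W \<epsilon> v t)) v" if "v \<in> {0<..<1}" for v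
        using P1[OF that ut(2)] by (simp add: DERIV_imp_deriv)
    qed (use ut in auto)
    then have "ft u t = E"
      using eq[OF ut] D(3)[OF ut] by (simp add: DERIV_imp_deriv)
    with E show ?thesis by simp
  qed
  show thesis
    using that[of ft Pu] ft D(3) P1 P2 by blast
qed

section \<open>Maximum principle and persistence of extinction\<close>

text \<open>At an interior spatial maximum the equation gives only a nonpositive time derivative.
  Subtracting \<open>\<eta> * (s - t)\<close> makes it strictly negative, which excludes a maximum
  there; then \<open>\<eta>\<close> tends to \<open>0\<close>.\<close>

lemma W_max_principle:
  assumes \<epsilon>: "0 < \<epsilon>" and t: "0 < t" "t \<le> s" and \<delta>: "\<And>v. v \<in> {0..1} \<Longrightarrow> W \<epsilon> v t \<le> \<delta>"
    and u: "u \<in> {0..1}"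
  shows "W \<epsilon> u s \<le> \<delta>"
proof -
  obtain Wt Pu where
    Wt: "\<And>u t. u \<in> {0<..<1} \<Longrightarrow> 0 < t \<Longrightarrow> (W \<epsilon> u has_real_derivative Wt u t) (at t)" and
    Pu: "\<And>u t. u \<in> {0<..<1} \<Longrightarrow> 0 < t \<Longrightarrow> ((\<lambda>v. \<Psi> (W \<epsilon> v t)) has_real_derivative Pu u t) (at u)" and
    Puu: "\<And>u t. u \<in> {0<..<1} \<Longrightarrow> 0 < t \<Longrightarrow> ((\<lambda>v. Pu v t) has_real_derivative Wt u t) (at u)"
    using W_equation[OF \<epsilon>] by metis
  have "W \<epsilon> u s \<le> \<delta> + \<eta> * (s - t)" if \<eta>: "0 < \<eta>" for \<eta>
  proof -
    let ?K = "{0..1::real} \<times> {t..s}"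
    let ?f = "\<lambda>x. W \<epsilon> (fst x) (snd x) - \<eta> * (snd x - t)"
    have "continuous_on ?K (\<lambda>x. W \<epsilon> (fst x) (snd x))"
    proof -
      have "?K \<subseteq> par_dom" using t by (auto simp: par_dom_def)
      then show ?thesis
        using continuous_on_subset[OF W_continuous[OF \<epsilon>]] by (simp add: case_prod_unfold)
    qed
    then have "continuous_on ?K ?f" by (intro continuous_intros)
    moreover have "compact ?K" by (intro compact_Times compact_Icc)
    moreover have "?K \<noteq> {}" using t by auto
    ultimately have "\<exists>x\<in>?K. \<forall>y\<in>?K. ?f y \<le> ?f x"
      by (intro continuous_attains_sup)
    then obtain x where x: "x \<in> ?K" "\<And>y. y \<in> ?K \<Longrightarrow> ?f y \<le> ?f x"
      by blast
    obtain v \<tau> where v\<tau>: "x = (v, \<tau>)" by (cases x)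
    with x have v: "v \<in> {0..1}" "\<tau> \<in> {t..s}" by auto
    have max: "W \<epsilon> v' \<tau>' - \<eta> * (\<tau>' - t) \<le> W \<epsilon> v \<tau> - \<eta> * (\<tau> - t)"
      if "v' \<in> {0..1}" "\<tau>' \<in> {t..s}" for v' \<tau>'
      using x(2)[of "(v', \<tau>')"] that v\<tau> by auto
    have "W \<epsilon> v \<tau> - \<eta> * (\<tau> - t) \<le> \<delta>"
    proof (rule ccontr)
      assume big: "\<not> W \<epsilon> v \<tau> - \<eta> * (\<tau> - t) \<le> \<delta>"
      \<comment> \<open>The boundary value \<open>\<epsilon>\<close> is itself one of the values
        bounded by \<open>\<delta>\<close>, so the large maximum cannot lie on the lateral
        boundary.\<close>
      have "\<epsilon> \<le> \<delta>" using \<delta>[of 0] W_boundary[OF \<epsilon> t(1)] by simp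
      have "\<tau> \<noteq> t" using big \<delta>[OF v(1)] by auto
      then have \<tau>: "t < \<tau>" "\<tau> \<le> s" using v by auto
      have "0 \<le> \<eta> * (\<tau> - t)" using \<eta> \<tau> by simp
      then have "v \<noteq> 0" "v \<noteq> 1"
        using big W_boundary[OF \<epsilon>, of \<tau>] \<open>\<epsilon> \<le> \<delta>\<close> t \<tau> by auto
      with v have v': "v \<in> {0<..<1}" by auto
      have \<tau>0: "0 < \<tau>" using t \<tau> by simp
      \<comment> \<open>The second derivative test is applied to
        \<open>\<Psi> (W \<epsilon>)\<close>, which has its maximum at the same point by
        monotonicity of \<open>\<Psi>\<close>.\<close>
      have "Wt v \<tau> \<le> 0"
      proof (rule second_DERIV_nonpos_at_max[OF v' _ Puu[OF v' \<tau>0]])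
        fix y :: real assume y: "y \<in> {0<..<1}"
        show "((\<lambda>v. \<Psi> (W \<epsilon> v \<tau>)) has_real_derivative Pu y \<tau>) (at y)" by (rule Pu[OF y \<tau>0])
        have "W \<epsilon> y \<tau> \<le> W \<epsilon> v \<tau>" using max[of y \<tau>] y v by auto
        moreover have "0 \<le> W \<epsilon> y \<tau>" using W_ge[OF \<epsilon>, of y \<tau>] y \<tau>0 \<epsilon> by auto
        ultimately show "\<Psi> (W \<epsilon> y \<tau>) \<le> \<Psi> (W \<epsilon> v \<tau>)" by (rule flux_mono[rotated])
      qed
      then have "Wt v \<tau> - \<eta> < 0" using \<eta> by simp
      moreover have "((\<lambda>\<tau>. W \<epsilon> v \<tau> - \<eta> * (\<tau> - t)) has_real_derivative Wt v \<tau> - \<eta>) (at \<tau>)"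
        by (auto intro!: derivative_eq_intros Wt v' \<tau>0)
      \<comment> \<open>The maximum may occur at the final time \<open>s\<close>, so it is compared
        with earlier times only.\<close>
      ultimately obtain d where d: "0 < d" "\<And>h. 0 < h \<Longrightarrow> h < d \<Longrightarrow>
          W \<epsilon> v \<tau> - \<eta> * (\<tau> - t) < W \<epsilon> v (\<tau> - h) - \<eta> * (\<tau> - h - t)"
        using DERIV_neg_dec_left by blast
      define h where "h = min d (\<tau> - t) / 2"
      have "0 < h" "h < d" "h < \<tau> - t" using d \<tau> by (auto simp: h_def)
      then show False using d(2)[of h] max[of v "\<tau> - h"] v \<tau> by auto
    qed
    then show ?thesis using max[of u s] u t by auto
  qed
  then have *: "W \<epsilon> u s \<le> \<delta> + \<eta> * (s - t)" if "0 < \<eta>" for \<eta> using that by blast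
  show ?thesis
  proof (rule field_le_epsilon)
    fix e :: real assume e: "0 < e"
    \<comment> \<open>The summand \<open>1\<close> covers the case \<open>s = t\<close>.\<close>
    have "e / (s - t + 1) * (s - t) \<le> e"
      using e t by (simp add: field_simps)
    then show "W \<epsilon> u s \<le> \<delta> + e" using *[of "e / (s - t + 1)"] e t by simp
  qed
qed

text \<open>Dini's theorem for \<open>W\<^sub>\<epsilon>(\<cdot>, t)\<close>, in the case of the zero limit.\<close>

lemma W_small_if_extinct:
  assumes t: "0 < t" and w: "\<And>u. u \<in> {0<..<1} \<Longrightarrow> w u t = 0" and \<delta>: "0 < \<delta>"
  obtains \<epsilon> where "0 < \<epsilon>" "\<epsilon> \<le> 1" "\<And>u. u \<in> {0..1} \<Longrightarrow> W \<epsilon> u t \<le> \<delta>"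
proof (rule ccontr)
  assume contra: "\<not> thesis"
  \<comment> \<open>The values \<open>1 / real (Suc n)\<close> are positive, at most
    \<open>1\<close> and tend to \<open>0\<close>; if none of them works, each has a point where
    \<open>\<delta>\<close> is exceeded.\<close>
  have "\<exists>u. u \<in> {0..1} \<and> \<delta> < W (1 / real (Suc n)) u t" for n
  proof (rule ccontr)
    assume "\<not> ?thesis"
    then have "W (1 / real (Suc n)) u t \<le> \<delta>" if "u \<in> {0..1}" for u
      using that by (auto simp: not_less)
    then show False using contra that[of "1 / real (Suc n)"] by simp
  qed
  then obtain f where f: "\<And>n. f n \<in> {0..1}" "\<And>n. \<delta> < W (1 / real (Suc n)) (f n) t"
    by metis
  obtain x r where x: "x \<in> {0..1}" "strict_mono (r :: nat \<Rightarrow> nat)" "(f \<circ> r) \<longlonglongrightarrow> x"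
    using seq_compactE[of "{0..1::real}" f] f(1) compact_Icc[of "0::real" 1]
    by (metis compact_imp_seq_compact)
  have "w x t = 0" using w[of x] w_boundary[OF t] x(1) by (cases "x = 0 \<or> x = 1") auto
  then have "\<forall>\<^sub>F \<epsilon> in at_right 0. W \<epsilon> x t < \<delta>"
    using order_tendstoD(2)[OF W_lim[of x t], of \<delta>] x(1) t \<delta> by auto
  then obtain b where b: "0 < b" "\<And>\<epsilon>. 0 < \<epsilon> \<Longrightarrow> \<epsilon> < b \<Longrightarrow> W \<epsilon> x t < \<delta>"
    by (auto simp: eventually_at_right_field)
  \<comment> \<open>One fixed \<open>\<epsilon>\<close> is small at the limit point
    \<open>x\<close>, hence by continuity at the nearby points of the subsequence. Monotonicity in
    \<open>\<epsilon>\<close> passes this to the smaller parameters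
    \<open>1 / real (Suc (r n))\<close>, a contradiction.\<close>
  define \<epsilon> where "\<epsilon> = b / 2"
  have \<epsilon>: "0 < \<epsilon>" "W \<epsilon> x t < \<delta>" using b by (auto simp: \<epsilon>_def)
  have "((\<lambda>n. W \<epsilon> ((f \<circ> r) n) t) \<longlonglongrightarrow> W \<epsilon> x t)"
    by (rule continuous_on_tendsto_compose[OF W_continuous_space[OF \<epsilon>(1) t] x(3,1)])
       (use f(1) in simp)
  then have "\<forall>\<^sub>F n in sequentially. W \<epsilon> ((f \<circ> r) n) t < \<delta>"
    using \<epsilon>(2) by (rule order_tendstoD(2))
  moreover have "\<forall>\<^sub>F n in sequentially. 1 / real (Suc (r n)) < \<epsilon>"
  proof -
    have "(\<lambda>n. 1 / real (Suc n)) \<longlonglongrightarrow> 0" by (rule LIMSEQ_Suc[OF lim_1_over_n])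
    from LIMSEQ_subseq_LIMSEQ[OF this x(2)] show ?thesis
      using order_tendstoD(2)[of _ 0 sequentially \<epsilon>] \<epsilon>(1) by (simp add: o_def)
  qed
  ultimately have "\<forall>\<^sub>F n in sequentially. W \<epsilon> ((f \<circ> r) n) t < \<delta> \<and> 1 / real (Suc (r n)) < \<epsilon>"
    by (rule eventually_conj)
  then obtain n where n: "W \<epsilon> (f (r n)) t < \<delta>" "1 / real (Suc (r n)) < \<epsilon>"
    by (auto simp: eventually_sequentially)
  have "W (1 / real (Suc (r n))) (f (r n)) t \<le> W \<epsilon> (f (r n)) t"
    using n(2) \<epsilon>(1) f(1)[of "r n"] t by (intro mono_onD[OF W_mono]) auto
  then show False using f(2)[of "r n"] n(1) by simp
qed

text \<open>The maximum principle is available for the approximations, so smallness passes from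
  \<open>w\<close> at time \<open>t\<close> to one \<open>W \<epsilon>\<close>, is kept until
  \<open>s\<close>, and returns to \<open>w\<close>.\<close>

lemma extinct_later:
  assumes t: "0 < t" "t \<le> s" and w: "\<And>u. u \<in> {0<..<1} \<Longrightarrow> w u t = 0" and u: "u \<in> {0<..<1}"
  shows "w u s = 0"
proof (rule antisym)
  show "w u s \<le> 0"
  proof (rule field_le_epsilon)
    fix e :: real assume "0 < e"
    then obtain \<epsilon> where "0 < \<epsilon>" "\<And>u. u \<in> {0..1} \<Longrightarrow> W \<epsilon> u t \<le> e"
      using W_small_if_extinct[OF t(1) w] by metis
    then have "W \<epsilon> u s \<le> e" using W_max_principle[of \<epsilon> t s e u] t u by auto
    then show "w u s \<le> 0 + e" using w_le_W[of \<epsilon> u s] \<open>0 < \<epsilon>\<close> u t by auto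
  qed
  show "0 \<le> w u s" using u t by (intro w_nonneg) auto
qed

section \<open>Weighted moments of the approximating solutions\<close>

lemma flux_W_integrable:
  assumes \<epsilon>: "0 < \<epsilon>" and t: "0 < t" and \<alpha>: "0 < \<alpha>" "\<beta> < 1"
  shows "(\<lambda>u. \<Psi> (W \<epsilon> u t)) integrable_on {\<alpha>..\<beta>}"
proof -
  obtain Wt Pu where
    Pu: "\<And>u t. u \<in> {0<..<1} \<Longrightarrow> 0 < t \<Longrightarrow> ((\<lambda>v. \<Psi> (W \<epsilon> v t)) has_real_derivative Pu u t) (at u)"
    using W_equation[OF \<epsilon>] by metis
  show ?thesis
  proof (rule integrable_continuous_real, rule DERIV_continuous_on)
    fix u assume "u \<in> {\<alpha>..\<beta>}"
    with \<alpha> have "u \<in> {0<..<1}" by auto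
    from Pu[OF this t]
    show "((\<lambda>u. \<Psi> (W \<epsilon> u t)) has_real_derivative Pu u t) (at u within {\<alpha>..\<beta>})"
      by (rule has_field_derivative_at_within)
  qed
qed

text \<open>Two integrations by parts. The weight vanishes at both ends, which removes the
  uncontrolled flux derivative \<open>Pu\<close>; its slopes there are
  \<open>\<beta> - \<alpha>\<close> and \<open>\<alpha> - \<beta>\<close>, and its second derivative
  is \<open>- 2\<close>.\<close>

lemma W_moment_deriv:
  assumes \<epsilon>: "0 < \<epsilon>" and \<alpha>\<beta>: "0 < \<alpha>" "\<alpha> < \<beta>" "\<beta> < 1" and t: "0 < t"
  shows "((\<lambda>s. integral {\<alpha>..\<beta>} (\<lambda>u. W \<epsilon> u s * ((u - \<alpha>) * (\<beta> - u)))) has_real_derivative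
     (\<beta> - \<alpha>) * (\<Psi> (W \<epsilon> \<alpha> t) + \<Psi> (W \<epsilon> \<beta> t)) - 2 * integral {\<alpha>..\<beta>} (\<lambda>u. \<Psi> (W \<epsilon> u t))) (at t)"
proof -
  obtain Wt Pu where
    cont: "continuous_on ({0<..<1} \<times> {0<..}) (\<lambda>(u, t). Wt u t)" and
    Wt: "\<And>u t. u \<in> {0<..<1} \<Longrightarrow> 0 < t \<Longrightarrow> (W \<epsilon> u has_real_derivative Wt u t) (at t)" and
    Pu: "\<And>u t. u \<in> {0<..<1} \<Longrightarrow> 0 < t \<Longrightarrow> ((\<lambda>v. \<Psi> (W \<epsilon> v t)) has_real_derivative Pu u t) (at u)" and
    Puu: "\<And>u t. u \<in> {0<..<1} \<Longrightarrow> 0 < t \<Longrightarrow> ((\<lambda>v. Pu v t) has_real_derivative Wt u t) (at u)"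
    using W_equation[OF \<epsilon>] by metis
  let ?\<phi> = "\<lambda>u. (u - \<alpha>) * (\<beta> - u)"
  have in01: "u \<in> {0<..<1}" if "u \<in> {\<alpha>..\<beta>}" for u using that \<alpha>\<beta> by auto
  have "((\<lambda>u. Wt u t * ?\<phi> u + 2 * \<Psi> (W \<epsilon> u t)) has_integral
     ((Pu \<beta> t * ?\<phi> \<beta> - \<Psi> (W \<epsilon> \<beta> t) * (\<alpha> + \<beta> - 2 * \<beta>))
      - (Pu \<alpha> t * ?\<phi> \<alpha> - \<Psi> (W \<epsilon> \<alpha> t) * (\<alpha> + \<beta> - 2 * \<alpha>)))) {\<alpha>..\<beta>}"
  \<comment> \<open>The two integrations by parts are done at once by an explicit antiderivative, in
    which \<open>\<alpha> + \<beta> - 2 * u\<close> is the derivative of the weight.\<close>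
  proof (rule has_integral_DERIV[where f="\<lambda>u. Pu u t * ?\<phi> u - \<Psi> (W \<epsilon> u t) * (\<alpha> + \<beta> - 2 * u)"])
    fix u assume "u \<in> {\<alpha>..\<beta>}"
    note u = in01[OF this]
    have "((\<lambda>u. Pu u t * ?\<phi> u - \<Psi> (W \<epsilon> u t) * (\<alpha> + \<beta> - 2 * u)) has_real_derivative
      (Wt u t * ?\<phi> u + (\<alpha> + \<beta> - 2 * u) * Pu u t) -
      (Pu u t * (\<alpha> + \<beta> - 2 * u) + (- 2) * \<Psi> (W \<epsilon> u t))) (at u)"
      by (intro DERIV_diff DERIV_mult Pu[OF u t] Puu[OF u t])
         (auto intro!: derivative_eq_intros)
    then show "((\<lambda>u. Pu u t * ?\<phi> u - \<Psi> (W \<epsilon> u t) * (\<alpha> + \<beta> - 2 * u)) has_real_derivative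
      Wt u t * ?\<phi> u + 2 * \<Psi> (W \<epsilon> u t)) (at u)"
      by (simp add: mult.commute)
  qed (use \<alpha>\<beta> in simp)
  moreover have "(\<lambda>u. \<Psi> (W \<epsilon> u t)) integrable_on {\<alpha>..\<beta>}"
    using \<epsilon> t \<alpha>\<beta> by (intro flux_W_integrable) auto
  ultimately have "((\<lambda>u. Wt u t * ?\<phi> u + 2 * \<Psi> (W \<epsilon> u t) - 2 * \<Psi> (W \<epsilon> u t)) has_integral
     (\<beta> - \<alpha>) * (\<Psi> (W \<epsilon> \<alpha> t) + \<Psi> (W \<epsilon> \<beta> t)) - 2 * integral {\<alpha>..\<beta>} (\<lambda>u. \<Psi> (W \<epsilon> u t))) {\<alpha>..\<beta>}"
    by (intro has_integral_diff has_integral_mult_right integrable_integral)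
       (simp_all add: algebra_simps)
  then have "integral {\<alpha>..\<beta>} (\<lambda>u. Wt u t * ?\<phi> u) =
     (\<beta> - \<alpha>) * (\<Psi> (W \<epsilon> \<alpha> t) + \<Psi> (W \<epsilon> \<beta> t)) - 2 * integral {\<alpha>..\<beta>} (\<lambda>u. \<Psi> (W \<epsilon> u t))"
    by (simp add: integral_unique)
  moreover have "((\<lambda>s. integral {\<alpha>..\<beta>} (\<lambda>u. W \<epsilon> u s * ?\<phi> u)) has_real_derivative
     integral {\<alpha>..\<beta>} (\<lambda>u. Wt u t * ?\<phi> u)) (at t)"
  proof (rule DERIV_integral_parameter[where I="{0<..}"])
    show "((\<lambda>s. W \<epsilon> u s * ?\<phi> u) has_real_derivative Wt u s * ?\<phi> u) (at s)"
      if "u \<in> {\<alpha>..\<beta>}" "s \<in> {0<..}" for u s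
      using Wt[OF in01[OF that(1)], of s] that(2) by (intro DERIV_cmult_right) auto
    show "continuous_on {\<alpha>..\<beta>} (\<lambda>u. W \<epsilon> u s * ?\<phi> u)" if "s \<in> {0<..}" for s
      using that \<alpha>\<beta> \<epsilon>
      by (intro continuous_intros continuous_on_subset[OF W_continuous_space]) auto
    have "continuous_on ({\<alpha>..\<beta>} \<times> {0<..}) (\<lambda>(u, t). Wt u t)"
      using \<alpha>\<beta> by (intro continuous_on_subset[OF cont]) auto
    then show "continuous_on ({\<alpha>..\<beta>} \<times> {0<..}) (\<lambda>(u, s). Wt u s * ?\<phi> u)"
      by (auto simp: case_prod_unfold intro!: continuous_intros)
  qed (use t in auto)
  ultimately show ?thesis by simp
qed

lemma one_le_M: "1 \<le> M"
  using W_ge[of 1 "1/2" 1] W_le[of 1 "1/2" 1] by simp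

text \<open>The argument \<open>2 * \<epsilon>\<close> is the bound that
  \<open>W_near_boundary\<close> yields with tolerance \<open>\<eta> = \<epsilon>\<close>.\<close>

lemma flux_small:
  assumes "0 < e"
  obtains \<epsilon> where "0 < \<epsilon>" "\<epsilon> \<le> 1" "\<Psi> (2 * \<epsilon>) - \<Psi> 0 \<le> e"
proof -
  have "\<forall>\<^sub>F x in at_right 0. \<Psi> x < \<Psi> 0 + e"
    using assms by (intro order_tendstoD(2)[OF flux_at_0]) simp
  then obtain b where b: "0 < b" "\<And>x. 0 < x \<Longrightarrow> x < b \<Longrightarrow> \<Psi> x < \<Psi> 0 + e"
    by (auto simp: eventually_at_right_field)
  show thesis
    using b(1) b(2)[of "2 * min 1 (b / 4)"] that[of "min 1 (b / 4)"] by force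
qed

text \<open>Supplies the smallness near the boundary, uniform in time, that
  \<open>potential_limit_mono\<close> asks of \<open>p\<close>.\<close>

lemma flux_near_boundary:
  assumes e: "0 < e" and t1: "0 < t1"
  obtains d where "0 < d"
    "\<And>u t. t \<in> {t1..t2} \<Longrightarrow> u \<in> {0<..<1} \<Longrightarrow> u < d \<or> 1 - d < u \<Longrightarrow> \<Psi> (w u t) - \<Psi> 0 \<le> e"
proof -
  obtain \<epsilon> where \<epsilon>: "0 < \<epsilon>" "\<Psi> (2 * \<epsilon>) - \<Psi> 0 \<le> e" using flux_small[OF e] by metis
  obtain d where d: "0 < d" "\<And>u t. t \<in> {t1..t2} \<Longrightarrow> u \<in> {0..1} \<Longrightarrow> u < d \<or> 1 - d < u \<Longrightarrow>
      W \<epsilon> u t \<le> \<epsilon> + \<epsilon>"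
    using W_near_boundary[OF \<epsilon>(1) t1 \<epsilon>(1)] by metis
  show thesis
  proof (rule that[OF d(1)])
    fix u t assume *: "t \<in> {t1..t2}" "u \<in> {0<..<1}" "u < d \<or> 1 - d < u"
    then have dom: "(u, t) \<in> par_dom" using t1 by simp
    have "w u t \<le> 2 * \<epsilon>" using w_le_W[OF \<epsilon>(1) dom] d(2)[of t u] * by auto
    then show "\<Psi> (w u t) - \<Psi> 0 \<le> e"
      using flux_mono[OF w_nonneg[OF dom]] \<epsilon>(2) by fastforce
  qed
qed

text \<open>The cut-off \<open>\<alpha> > 0\<close> keeps the ends of integration inside
  \<open>(0, 1)\<close>, where \<open>W_moment_deriv\<close> applies.\<close>

definition moment :: "real \<Rightarrow> real \<Rightarrow> real \<Rightarrow> real" where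
  "moment \<alpha> \<epsilon> t = integral {\<alpha>..1 - \<alpha>} (\<lambda>u. W \<epsilon> u t * ((u - \<alpha>) * (1 - \<alpha> - u)))"

lemma moment_integrable:
  assumes "0 < \<epsilon>" "0 < t" "0 \<le> \<alpha>"
  shows "(\<lambda>u. W \<epsilon> u t * ((u - \<alpha>) * (1 - \<alpha> - u))) integrable_on {\<alpha>..1 - \<alpha>}"
  using assms
  by (intro integrable_continuous_real continuous_intros continuous_on_subset[OF W_continuous_space])
     auto

lemma moment_nonneg:
  assumes "0 < \<epsilon>" "0 < t" "0 \<le> \<alpha>"
  shows "0 \<le> moment \<alpha> \<epsilon> t"
  unfolding moment_def
proof (rule integral_nonneg[OF moment_integrable[OF assms]])
  fix u assume u: "u \<in> {\<alpha>..1 - \<alpha>}"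
  then have "\<epsilon> \<le> W \<epsilon> u t" using assms by (intro W_ge) auto
  then show "0 \<le> W \<epsilon> u t * ((u - \<alpha>) * (1 - \<alpha> - u))" using u assms by simp
qed

lemma moment_upper:
  assumes "0 < \<epsilon>" "0 < t" "0 \<le> \<alpha>" "\<alpha> \<le> 1 - \<alpha>"
    and \<delta>: "\<And>u. u \<in> {0..1} \<Longrightarrow> W \<epsilon> u t \<le> \<delta>"
  shows "moment \<alpha> \<epsilon> t \<le> \<delta>"
proof -
  have "0 \<le> \<delta>" using \<delta>[of 0] W_boundary[of \<epsilon> t] assms by simp
  have "moment \<alpha> \<epsilon> t \<le> integral {\<alpha>..1 - \<alpha>} (\<lambda>u. \<delta>)"
    unfolding moment_def
  proof (rule integral_le[OF moment_integrable])
    fix u assume u: "u \<in> {\<alpha>..1 - \<alpha>}"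
    have "W \<epsilon> u t * ((u - \<alpha>) * (1 - \<alpha> - u)) \<le> \<delta> * (1 * 1)"
      using u assms \<open>0 \<le> \<delta>\<close> by (intro mult_mono \<delta>) auto
    then show "W \<epsilon> u t * ((u - \<alpha>) * (1 - \<alpha> - u)) \<le> \<delta>" by simp
  qed (use assms in auto)
  also have "\<dots> = (1 - 2 * \<alpha>) * \<delta>" using assms by simp
  also have "\<dots> \<le> 1 * \<delta>" using assms \<open>0 \<le> \<delta>\<close> by (intro mult_right_mono) auto
  finally show ?thesis by simp
qed

lemma moment_deriv:
  assumes "0 < \<epsilon>" "0 < \<alpha>" "\<alpha> < 1 - \<alpha>" "0 < t"
  shows "(moment \<alpha> \<epsilon> has_real_derivative
     (1 - 2 * \<alpha>) * (\<Psi> (W \<epsilon> \<alpha> t) + \<Psi> (W \<epsilon> (1 - \<alpha>) t))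
      - 2 * integral {\<alpha>..1 - \<alpha>} (\<lambda>u. \<Psi> (W \<epsilon> u t))) (at t)"
  using W_moment_deriv[of \<epsilon> \<alpha> "1 - \<alpha>" t] assms by (simp add: moment_def[abs_def])

text \<open>The end terms of the derivative are at least \<open>\<Psi> 0\<close> and the integrand
  is at most \<open>\<Psi> M\<close>. The rate is thus independent of \<open>\<epsilon>\<close> and
  \<open>\<alpha>\<close>, so \<open>\<epsilon>\<close> may be chosen after the time
  interval.\<close>

lemma moment_decrease_le:
  assumes \<epsilon>: "0 < \<epsilon>" "\<epsilon> \<le> 1" and \<alpha>: "0 < \<alpha>" "\<alpha> < 1 - \<alpha>" and t: "0 < t" "t < s"
  shows "moment \<alpha> \<epsilon> t - moment \<alpha> \<epsilon> s \<le> 2 * (\<Psi> M - \<Psi> 0) * (s - t)"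
proof -
  obtain \<tau> where \<tau>: "t < \<tau>" "\<tau> < s" "moment \<alpha> \<epsilon> s - moment \<alpha> \<epsilon> t = (s - t) *
      ((1 - 2 * \<alpha>) * (\<Psi> (W \<epsilon> \<alpha> \<tau>) + \<Psi> (W \<epsilon> (1 - \<alpha>) \<tau>))
        - 2 * integral {\<alpha>..1 - \<alpha>} (\<lambda>u. \<Psi> (W \<epsilon> u \<tau>)))" (is "_ = _ * (_ * (?a + ?b) - 2 * ?i)")
  proof -
    have "(moment \<alpha> \<epsilon> has_real_derivative
       (1 - 2 * \<alpha>) * (\<Psi> (W \<epsilon> \<alpha> \<tau>) + \<Psi> (W \<epsilon> (1 - \<alpha>) \<tau>))
        - 2 * integral {\<alpha>..1 - \<alpha>} (\<lambda>u. \<Psi> (W \<epsilon> u \<tau>))) (at \<tau>)" if "t \<le> \<tau>" for \<tau>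
      using \<epsilon> \<alpha> t that by (intro moment_deriv) auto
    from MVT2[OF t(2) this] that show thesis by blast
  qed
  have \<tau>0: "0 < \<tau>" using \<tau> t by simp
  have pos: "0 \<le> W \<epsilon> u \<tau>" if "u \<in> {0..1}" for u using W_ge[of \<epsilon> u \<tau>] that \<epsilon> \<tau>0 by auto
  have "?a \<ge> \<Psi> 0" "?b \<ge> \<Psi> 0" using \<alpha> by (auto intro!: flux_mono pos)
  then have "(1 - 2 * \<alpha>) * (\<Psi> 0 + \<Psi> 0) \<le> (1 - 2 * \<alpha>) * (?a + ?b)"
    using \<alpha> by (intro mult_left_mono) auto
  moreover have "?i \<le> integral {\<alpha>..1 - \<alpha>} (\<lambda>u. \<Psi> M)"
    using \<alpha> \<epsilon> \<tau>0
    by (intro integral_le flux_W_integrable) (auto intro!: flux_mono pos W_le)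
  then have "?i \<le> (1 - 2 * \<alpha>) * \<Psi> M" using \<alpha> by simp
  moreover have "(1 - 2 * \<alpha>) * (\<Psi> M - \<Psi> 0) \<le> 1 * (\<Psi> M - \<Psi> 0)"
    using \<alpha> flux_mono[of 0 M] one_le_M by (intro mult_right_mono) auto
  ultimately have "- (2 * (\<Psi> M - \<Psi> 0)) \<le> (1 - 2 * \<alpha>) * (?a + ?b) - 2 * ?i"
    by (simp add: algebra_simps)
  from mult_left_mono[OF this, of "s - t"] \<tau>(3) t show ?thesis
    by (simp add: algebra_simps)
qed

end

subsection \<open>The potential\<close>

locale conjugate_potential = conjugate_limit +
  fixes T :: ereal and z :: "real \<Rightarrow> real \<Rightarrow> real"
  assumes T_eq: "T = extinction_time w"
    and T_pos: "0 < T"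
    and z_integrated: "integrated_function \<Psi> w T z"
begin

abbreviation lifetime :: "real set" where
  "lifetime \<equiv> {t. 0 < t \<and> ereal t < T}"

lemma lifetime_cases:
  obtains \<tau> where "lifetime = {0<..<\<tau>}" | "lifetime = {0<..}"
proof (cases T)
  case (real \<tau>)
  then have "lifetime = {0<..<\<tau>}" by auto
  then show thesis by (rule that)
next
  case PInf
  then have "lifetime = {0<..}" by auto
  then show thesis by (rule that)
qed (use T_pos in simp)

lemma lifetime_open: "open lifetime"
  by (rule lifetime_cases) simp_all

lemma lifetime_convex: "convex lifetime"
  by (rule lifetime_cases) simp_all

lemma z_deriv_space:
  "u \<in> {0<..<1} \<Longrightarrow> 0 \<le> t \<Longrightarrow> ereal t < T \<Longrightarrow> ((\<lambda>v. z v t) has_real_derivative w u t) (at u)"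
  using z_integrated by (auto simp: integrated_function_def)

text \<open>\<open>integrated_function\<close> gives the common derivative \<open>q\<close> point by
  point; smoothness of \<open>z\<close> gives a continuous time derivative. Uniqueness of
  derivatives identifies the two.\<close>

lemma z_deriv_time:
  obtains q where "continuous_on ({0<..<1} \<times> lifetime) (\<lambda>(u, t). q u t)"
    "\<And>u t. u \<in> {0<..<1} \<Longrightarrow> t \<in> lifetime \<Longrightarrow> (z u has_real_derivative q u t) (at t)"
    "\<And>u t. u \<in> {0<..<1} \<Longrightarrow> t \<in> lifetime \<Longrightarrow> ((\<lambda>v. \<Psi> (w v t)) has_real_derivative q u t) (at u)"
proof -
  have "smooth_on ({0<..<1} \<times> lifetime) (\<lambda>(u, t). z u t)"
    using z_integrated by (simp add: integrated_function_def)
  then obtain q where q: "continuous_on ({0<..<1} \<times> lifetime) (\<lambda>(u, t). q u t)"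
    "\<And>u t. (u, t) \<in> {0<..<1} \<times> lifetime \<Longrightarrow> (z u has_real_derivative q u t) (at t)"
    using smooth_on_partial_derivative by blast
  have "((\<lambda>v. \<Psi> (w v t)) has_real_derivative q u t) (at u)"
    if "u \<in> {0<..<1}" "t \<in> lifetime" for u t
  proof -
    obtain q' where "((\<lambda>v. \<Psi> (w v t)) has_real_derivative q') (at u)"
      "(z u has_real_derivative q') (at t)"
      using z_integrated \<open>u \<in> {0<..<1}\<close> \<open>t \<in> lifetime\<close>
      unfolding integrated_function_def by blast
    moreover have "(z u has_real_derivative q u t) (at t)" using q(2) that by blast
    ultimately show ?thesis using DERIV_unique by metis
  qed
  with q that show thesis by auto
qed

section \<open>Lateral limits of the potential and their continuity in time\<close>

definition z_left :: "real \<Rightarrow> real" where "z_left t = Lim (at_right 0) (\<lambda>u. z u t)"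

definition z_right :: "real \<Rightarrow> real" where "z_right t = Lim (at_left 1) (\<lambda>u. z u t)"

lemma z_left:
  assumes t: "0 \<le> t" "ereal t < T"
  shows "((\<lambda>u. z u t) \<longlongrightarrow> z_left t) (at_right 0)"
    "u \<in> {0<..<1} \<Longrightarrow> z_left t \<le> z u t" "u \<in> {0<..<1} \<Longrightarrow> z u t \<le> z_left t + M * u"
proof -
  obtain c where c: "((\<lambda>u. z u t) \<longlongrightarrow> c) (at_right 0)"
    "\<And>u. u \<in> {0<..<1} \<Longrightarrow> c \<le> z u t" "\<And>u. u \<in> {0<..<1} \<Longrightarrow> z u t \<le> c + M * u"
  proof (rule bounded_slope_limit_at_0)
    fix u :: real assume u: "u \<in> {0<..<1}"
    then have "(u, t) \<in> par_dom" using t by simp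
    then show "0 \<le> w u t" "w u t \<le> M" by (rule w_nonneg, rule w_le)
    show "((\<lambda>u. z u t) has_real_derivative w u t) (at u)" by (rule z_deriv_space[OF u t])
  qed blast
  moreover have "z_left t = c" unfolding z_left_def using c(1) by (intro tendsto_Lim) auto
  ultimately show "((\<lambda>u. z u t) \<longlongrightarrow> z_left t) (at_right 0)"
    "u \<in> {0<..<1} \<Longrightarrow> z_left t \<le> z u t" "u \<in> {0<..<1} \<Longrightarrow> z u t \<le> z_left t + M * u"
    by auto
qed

lemma z_right:
  assumes t: "0 \<le> t" "ereal t < T"
  shows "((\<lambda>u. z u t) \<longlongrightarrow> z_right t) (at_left 1)"
    "u \<in> {0<..<1} \<Longrightarrow> z u t \<le> z_right t" "u \<in> {0<..<1} \<Longrightarrow> z_right t \<le> z u t + M * (1 - u)"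
proof -
  \<comment> \<open>\<open>- z (1 - u) t\<close> again has slope in \<open>[0, M]\<close>, so the
    left case applies; the sign turns its infimum into a supremum of \<open>z\<close>.\<close>
  obtain c where c: "((\<lambda>u. - z (1 - u) t) \<longlongrightarrow> c) (at_right 0)"
    "\<And>u. u \<in> {0<..<1} \<Longrightarrow> c \<le> - z (1 - u) t" "\<And>u. u \<in> {0<..<1} \<Longrightarrow> - z (1 - u) t \<le> c + M * u"
  proof (rule bounded_slope_limit_at_0)
    fix u :: real assume u: "u \<in> {0<..<1}"
    then have u': "1 - u \<in> {0<..<1}" by auto
    then have "(1 - u, t) \<in> par_dom" using t by (intro par_domI)
    then show "0 \<le> w (1 - u) t" "w (1 - u) t \<le> M" by (rule w_nonneg, rule w_le)
    have "((\<lambda>u. z (1 - u) t) has_real_derivative w (1 - u) t * (- 1)) (at u)"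
      by (rule DERIV_chain2[where f="\<lambda>u. z u t" and g="\<lambda>u. 1 - u"], rule z_deriv_space[OF u' t])
         (auto intro!: derivative_eq_intros)
    from DERIV_minus[OF this]
    show "((\<lambda>u. - z (1 - u) t) has_real_derivative w (1 - u) t) (at u)" by simp
  qed blast
  have "((\<lambda>u. - (- z (1 - (1 - u)) t)) \<longlongrightarrow> - c) (at_left 1)"
    by (intro tendsto_minus filterlim_compose[OF c(1) filterlim_reflect_at_left])
  then have lim: "((\<lambda>u. z u t) \<longlongrightarrow> - c) (at_left 1)" by simp
  moreover have "z_right t = - c" unfolding z_right_def using lim by (intro tendsto_Lim) auto
  ultimately show "((\<lambda>u. z u t) \<longlongrightarrow> z_right t) (at_left 1)"
    "u \<in> {0<..<1} \<Longrightarrow> z u t \<le> z_right t" "u \<in> {0<..<1} \<Longrightarrow> z_right t \<le> z u t + M * (1 - u)"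
    using c(2)[of "1 - u"] c(3)[of "1 - u"] by auto
qed

lemma z_continuous_time:
  assumes u: "u \<in> {0<..<1}"
  shows "continuous_on {t. 0 \<le> t \<and> ereal t < T} (z u)"
proof -
  have "continuous_on ({0<..<1} \<times> {t. 0 \<le> t \<and> ereal t < T}) (\<lambda>(u, t). z u t)"
    using z_integrated by (simp add: integrated_function_def)
  then have "continuous_on {t. 0 \<le> t \<and> ereal t < T} (\<lambda>t. case (u, t) of (u, t) \<Rightarrow> z u t)"
    by (rule continuous_on_compose2) (use u in \<open>auto intro!: continuous_intros\<close>)
  then show ?thesis by simp
qed

lemma z_left_continuous: "continuous_on {t. 0 \<le> t \<and> ereal t < T} z_left"
proof (rule uniform_boundary_limit_continuous[OF z_continuous_time])
  fix u t :: real assume *: "u \<in> {0<..<1}" "t \<in> {t. 0 \<le> t \<and> ereal t < T}"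
  then show "\<bar>z u t - z_left t\<bar> \<le> M * u" using z_left(2,3)[of t u] by auto
qed

lemma z_right_continuous: "continuous_on {t. 0 \<le> t \<and> ereal t < T} z_right"
proof (rule uniform_boundary_limit_continuous)
  fix u :: real assume "u \<in> {0<..<1}"
  then show "continuous_on {t. 0 \<le> t \<and> ereal t < T} (z (1 - u))"
    by (intro z_continuous_time) auto
next
  fix u t :: real assume *: "u \<in> {0<..<1}" "t \<in> {t. 0 \<le> t \<and> ereal t < T}"
  then show "\<bar>z (1 - u) t - z_right t\<bar> \<le> M * u" using z_right(2,3)[of t "1 - u"] by auto
qed

lemma z_continuous_space:
  assumes "t \<in> lifetime"
  shows "continuous_on {0<..<1} (\<lambda>u. z u t)"
  using assms z_deriv_space[of _ t]
  by (intro DERIV_continuous_on) (auto intro: has_field_derivative_at_within)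

section \<open>Monotonicity in time and comparison with the initial state\<close>

text \<open>Both claims apply \<open>potential_limit_mono\<close> to
  \<open>p = \<Psi>(w) - \<Psi>(0)\<close>, which is nonnegative and small near the lateral boundary
  for times in \<open>[t1, t2]\<close>.\<close>

lemma
  assumes t: "t1 \<in> lifetime" "t2 \<in> lifetime" "t1 \<le> t2"
  shows z_left_mono: "z_left t1 \<le> z_left t2" and z_right_antimono: "z_right t2 \<le> z_right t1"
proof -
  obtain q where q: "continuous_on ({0<..<1} \<times> lifetime) (\<lambda>(u, t). q u t)"
    and zt: "\<And>u t. u \<in> {0<..<1} \<Longrightarrow> t \<in> lifetime \<Longrightarrow> (z u has_real_derivative q u t) (at t)"
    and pu: "\<And>u t. u \<in> {0<..<1} \<Longrightarrow> t \<in> lifetime \<Longrightarrow> ((\<lambda>v. \<Psi> (w v t)) has_real_derivative q u t) (at u)"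
    using z_deriv_time by blast
  have p: "0 \<le> \<Psi> (w u t) - \<Psi> 0" if "u \<in> {0<..<1}" "t \<in> lifetime" for u t
    using flux_mono[of 0 "w u t"] w_nonneg[of u t] that by auto
  have refl: "1 - u \<in> {0<..<1}" if "u \<in> {0<..<1}" for u :: real using that by auto
  show "z_left t1 \<le> z_left t2"
  proof (cases "t1 = t2")
    case False
    with t have "t1 < t2" by simp
    show ?thesis
    proof (rule potential_limit_mono[where p="\<lambda>u t. \<Psi> (w u t) - \<Psi> 0", OF zt _ q z_continuous_space p _
          lifetime_open lifetime_convex t(1,2) \<open>t1 < t2\<close>])
      show "((\<lambda>v. \<Psi> (w v t) - \<Psi> 0) has_real_derivative q u t) (at u)"
        if "u \<in> {0<..<1}" "t \<in> lifetime" for u t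
        using DERIV_diff[OF pu[OF that] DERIV_const[of "\<Psi> 0"]] by simp
      show "\<exists>d>0. \<forall>u\<in>{0<..<d}. \<forall>t\<in>{t1..t2}. \<Psi> (w u t) - \<Psi> 0 \<le> e" if e: "0 < e" for e
      proof -
        obtain d where d: "0 < d" "\<And>u t. t \<in> {t1..t2} \<Longrightarrow> u \<in> {0<..<1} \<Longrightarrow> u < d \<or> 1 - d < u \<Longrightarrow>
            \<Psi> (w u t) - \<Psi> 0 \<le> e"
          using flux_near_boundary[OF e, of t1 t2] t(1) by blast
        then show ?thesis by (intro exI[of _ "min d 1"]) auto
      qed
    qed (use t z_left(1) in auto)
  qed simp
  show "z_right t2 \<le> z_right t1"
  proof (cases "t1 = t2")
    case False
    with t have "t1 < t2" by simp
    \<comment> \<open>Reflecting space and negating \<open>z\<close> preserves the relation between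
      \<open>z\<close> and \<open>p\<close>: both derivatives become
      \<open>- q (1 - u) t\<close>.\<close>
    have "- z_right t1 \<le> - z_right t2"
    proof (rule potential_limit_mono[where z="\<lambda>u t. - z (1 - u) t" and p="\<lambda>u t. \<Psi> (w (1 - u) t) - \<Psi> 0"
          and q="\<lambda>u t. - q (1 - u) t", OF _ _ _ _ p[OF refl] _
          lifetime_open lifetime_convex t(1,2) \<open>t1 < t2\<close>])
      show "((\<lambda>t. - z (1 - u) t) has_real_derivative - q (1 - u) t) (at t)"
        if "u \<in> {0<..<1}" "t \<in> lifetime" for u t
        by (rule DERIV_minus[OF zt[OF refl[OF that(1)] that(2)]])
      show "((\<lambda>v. \<Psi> (w (1 - v) t) - \<Psi> 0) has_real_derivative - q (1 - u) t) (at u)"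
        if "u \<in> {0<..<1}" "t \<in> lifetime" for u t
      proof -
        have "((\<lambda>v. \<Psi> (w (1 - v) t)) has_real_derivative q (1 - u) t * (- 1)) (at u)"
          by (rule DERIV_chain2[where f="\<lambda>u. \<Psi> (w u t)" and g="\<lambda>u. 1 - u"],
              rule pu[OF refl[OF that(1)] that(2)])
             (auto intro!: derivative_eq_intros)
        from DERIV_diff[OF this DERIV_const[of "\<Psi> 0"]] show ?thesis by simp
      qed
      have "continuous_on ({0<..<1} \<times> lifetime) (\<lambda>x. case (1 - fst x, snd x) of (u, t) \<Rightarrow> q u t)"
        by (rule continuous_on_compose2[OF q]) (auto intro!: continuous_intros)
      then show "continuous_on ({0<..<1} \<times> lifetime) (\<lambda>(u, t). - q (1 - u) t)"
        by (simp add: case_prod_unfold continuous_on_minus)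
      show "continuous_on {0<..<1} (\<lambda>u. - z (1 - u) t)" if "t \<in> lifetime" for t
        by (intro continuous_on_minus continuous_on_compose2[OF z_continuous_space[OF that]])
           (auto intro!: continuous_intros)
      show "\<exists>d>0. \<forall>u\<in>{0<..<d}. \<forall>t\<in>{t1..t2}. \<Psi> (w (1 - u) t) - \<Psi> 0 \<le> e" if e: "0 < e" for e
      proof -
        obtain d where d: "0 < d" "\<And>u t. t \<in> {t1..t2} \<Longrightarrow> u \<in> {0<..<1} \<Longrightarrow> u < d \<or> 1 - d < u \<Longrightarrow>
            \<Psi> (w u t) - \<Psi> 0 \<le> e"
          using flux_near_boundary[OF e, of t1 t2] t(1) by blast
        then show ?thesis by (intro exI[of _ "min d 1"]) auto
      qed
      show "((\<lambda>u. - z (1 - u) t1) \<longlongrightarrow> - z_right t1) (at_right 0)"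
        "((\<lambda>u. - z (1 - u) t2) \<longlongrightarrow> - z_right t2) (at_right 0)"
        using t by (auto intro!: tendsto_minus filterlim_compose[OF z_right(1) filterlim_reflect_at_right])
    qed
    then show ?thesis by simp
  qed simp
qed

text \<open>Monotonicity was shown for positive times, where the lateral boundary is under control;
  continuity of \<open>z_left\<close> at \<open>0\<close> extends it to the initial time.\<close>

lemma z_left_ge_initial:
  assumes t: "t \<in> lifetime"
  shows "z_left 0 \<le> z_left t"
proof -
  have "continuous_on {0..t} z_left"
    by (rule continuous_on_subset[OF z_left_continuous])
       (use t in \<open>auto intro: le_less_trans[of _ "ereal t"]\<close>)
  then have "(z_left \<longlongrightarrow> z_left 0) (at_right 0)"
    using t by (simp add: continuous_on_Icc_at_rightD)
  then show ?thesis
  proof (rule tendsto_upperbound)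
    have "z_left s \<le> z_left t" if "0 < s" "s < t" for s
      using t that by (intro z_left_mono) (auto intro: less_trans[of _ "ereal t"])
    then show "\<forall>\<^sub>F s in at_right 0. z_left s \<le> z_left t"
      using t by (auto simp: eventually_at_right_field)
  qed simp
qed

lemma z_right_le_initial:
  assumes t: "t \<in> lifetime"
  shows "z_right t \<le> z_right 0"
proof -
  have "continuous_on {0..t} z_right"
    by (rule continuous_on_subset[OF z_right_continuous])
       (use t in \<open>auto intro: le_less_trans[of _ "ereal t"]\<close>)
  then have "(z_right \<longlongrightarrow> z_right 0) (at_right 0)"
    using t by (simp add: continuous_on_Icc_at_rightD)
  then show ?thesis
  proof (rule tendsto_lowerbound)
    have "z_right t \<le> z_right s" if "0 < s" "s < t" for s
      using t that by (intro z_right_antimono) (auto intro: less_trans[of _ "ereal t"])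
    then show "\<forall>\<^sub>F s in at_right 0. z_right t \<le> z_right s"
      using t by (auto simp: eventually_at_right_field)
  qed simp
qed

lemma extinct_after:
  assumes "T < ereal s" "0 \<le> s" "u \<in> {0<..<1}"
  shows "w u s = 0"
proof (rule ccontr)
  assume "w u s \<noteq> 0"
  then have "ereal s \<le> T"
    unfolding T_eq extinction_time_def using assms by (intro Sup_upper) blast
  then show False using assms(1) by simp
qed

text \<open>As a supremum, \<open>T\<close> by itself does not exclude extinct times before it. By
  \<open>extinct_later\<close> such a time would force \<open>T \<le> t\<close>. One point with
  \<open>w > 0\<close> then makes the nondecreasing \<open>z\<close> grow strictly.\<close>

lemma z_left_less_right:
  assumes t: "t \<in> lifetime"
  shows "z_left t < z_right t"
proof -
  have "\<exists>u\<in>{0<..<1}. w u t \<noteq> 0"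
  proof (rule ccontr)
    assume "\<not> ?thesis"
    then have "w u s = 0" if "t \<le> s" "u \<in> {0<..<1}" for u s
      using extinct_later[of t s u] t that by auto
    then have "s \<le> t" if "\<exists>u\<in>{0<..<1}. w u s \<noteq> 0" for s
      using that by (meson not_le less_imp_le)
    then have "x \<le> ereal t" if "x \<in> ereal ` {s. 0 \<le> s \<and> (\<exists>u\<in>{0<..<1}. w u s \<noteq> 0)}" for x
      using that by fastforce
    then have "T \<le> ereal t"
      unfolding T_eq extinction_time_def by (intro Sup_least) blast
    then show False using t by auto
  qed
  then obtain u where u: "u \<in> {0<..<1}" "w u t \<noteq> 0" by blast
  then have "0 < w u t" using w_nonneg[of u t] t by auto
  moreover have "((\<lambda>v. z v t) has_real_derivative w u t) (at u)"
    using u t by (intro z_deriv_space) auto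
  ultimately obtain d where d: "0 < d" "\<And>h. 0 < h \<Longrightarrow> h < d \<Longrightarrow> z u t < z (u + h) t"
    using DERIV_pos_inc_right by blast
  define h where "h = min d (1 - u) / 2"
  have h: "0 < h" "h < d" "h < 1 - u" using d u by (auto simp: h_def)
  have "z_left t \<le> z u t" using z_left(2)[of t u] u t by auto
  also have "\<dots> < z (u + h) t" using d(2) h by blast
  also have "\<dots> \<le> z_right t" using z_right(2)[of t "u + h"] u h t by auto
  finally show ?thesis .
qed

section \<open>Decay of the mass at the extinction time\<close>

lemma w_has_integral:
  assumes "t \<in> lifetime" "0 < \<alpha>" "\<alpha> \<le> \<beta>" "\<beta> < 1"
  shows "((\<lambda>u. w u t) has_integral (z \<beta> t - z \<alpha> t)) {\<alpha>..\<beta>}"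
  using assms by (intro has_integral_DERIV[where f="\<lambda>u. z u t"] z_deriv_space) auto

text \<open>Since \<open>w \<le> M\<close>, each of the two boundary layers of width
  \<open>\<alpha>\<close> carries mass at most \<open>M * \<alpha>\<close>.\<close>

lemma mass_interior_ge:
  assumes "t \<in> lifetime" "0 < \<alpha>" "\<alpha> < 1"
  shows "z_right t - z_left t - 2 * M * \<alpha> \<le> z (1 - \<alpha>) t - z \<alpha> t"
  using z_left(3)[of t \<alpha>] z_right(3)[of t "1 - \<alpha>"] assms by auto

text \<open>The moment is compared at \<open>\<tau> - h\<close> and \<open>\<tau> + h\<close>: mass
  makes it at least \<open>4 * \<delta>\<close> before, extinction at most \<open>\<delta>\<close>
  after, and it can lose at most \<open>\<delta>\<close> in between. The later time lies beyond
  \<open>\<tau>\<close> because \<open>extinct_after\<close> says nothing at \<open>\<tau>\<close>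
  itself.\<close>

lemma mass_vanishes_finite:
  assumes T: "T = ereal \<tau>" and m: "0 < m" and mass: "\<And>t. t \<in> lifetime \<Longrightarrow> m \<le> z_right t - z_left t"
  shows False
proof -
  have \<tau>: "0 < \<tau>" using T T_pos by simp
  have M: "1 \<le> M" by (rule one_le_M)
  \<comment> \<open>At least \<open>m / 2\<close> of the mass then lies in
    \<open>[2 * \<alpha>, 1 - 2 * \<alpha>]\<close>, where the weight is at least
    \<open>\<alpha> * \<alpha>\<close>.\<close>
  define \<alpha> where "\<alpha> = min (1 / 8) (m / (8 * M))"
  have \<alpha>: "0 < \<alpha>" "\<alpha> \<le> 1 / 8" using m M by (auto simp: \<alpha>_def)
  have "M * \<alpha> \<le> M * (m / (8 * M))" using M by (intro mult_left_mono) (auto simp: \<alpha>_def)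
  then have \<alpha>M: "2 * M * (2 * \<alpha>) \<le> m / 2" using M by simp
  define C where "C = 2 * (\<Psi> M - \<Psi> 0)"
  have C: "0 \<le> C" using flux_mono[of 0 M] M by (simp add: C_def)
  have lower: "\<alpha> * \<alpha> * (m / 2) \<le> moment \<alpha> \<epsilon> t" if \<epsilon>: "0 < \<epsilon>" and t: "t \<in> lifetime" for \<epsilon> t
  proof -
    let ?f = "\<lambda>u. W \<epsilon> u t * ((u - \<alpha>) * (1 - \<alpha> - u))"
    have t0: "0 < t" using t by simp
    have int: "?f integrable_on {\<alpha>..1 - \<alpha>}" using \<epsilon> t0 \<alpha> by (intro moment_integrable) auto
    have int': "?f integrable_on {2 * \<alpha>..1 - 2 * \<alpha>}"
      by (rule integrable_on_subinterval[OF int]) (use \<alpha> in auto)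
    have pos: "0 \<le> W \<epsilon> u t" if "u \<in> {0..1}" for u using W_ge[of \<epsilon> u t] that \<epsilon> t0 by auto
    have "m / 2 \<le> z (1 - 2 * \<alpha>) t - z (2 * \<alpha>) t"
      using mass_interior_ge[OF t, of "2 * \<alpha>"] mass[OF t] \<alpha> \<alpha>M by auto
    then have "\<alpha> * \<alpha> * (m / 2) \<le> \<alpha> * \<alpha> * (z (1 - 2 * \<alpha>) t - z (2 * \<alpha>) t)"
      using \<alpha> by (intro mult_left_mono) auto
    also have "\<dots> \<le> integral {2 * \<alpha>..1 - 2 * \<alpha>} ?f"
    proof (rule has_integral_le[OF has_integral_mult_right[OF w_has_integral[OF t]] integrable_integral[OF int']])
      fix u assume u: "u \<in> {2 * \<alpha>..1 - 2 * \<alpha>}"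
      have dom: "(u, t) \<in> par_dom" using u \<alpha> t0 by (intro par_domI) auto
      have "w u t * (\<alpha> * \<alpha>) \<le> ?f u"
        using u \<alpha> by (intro mult_mono w_le_W \<epsilon> dom pos) auto
      then show "\<alpha> * \<alpha> * w u t \<le> ?f u" by (simp add: mult.commute)
    qed (use \<alpha> in auto)
    also have "\<dots> \<le> moment \<alpha> \<epsilon> t"
      unfolding moment_def
    proof (rule integral_subset_le[OF _ int' int])
      show "\<forall>u\<in>{\<alpha>..1 - \<alpha>}. 0 \<le> ?f u"
        using \<alpha> by (auto intro!: mult_nonneg_nonneg pos)
    qed (use \<alpha> in auto)
    finally show ?thesis .
  qed
  \<comment> \<open>A quarter of the lower bound for the moment.\<close>
  define \<delta> where "\<delta> = \<alpha> * \<alpha> * m / 8"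
  have \<delta>: "0 < \<delta>" using \<alpha> m by (simp add: \<delta>_def)
  \<comment> \<open>The first bound keeps \<open>\<tau> - h\<close> positive, the second limits the
    loss over time \<open>2 * h\<close> to \<open>\<delta>\<close>; \<open>C + 1\<close> avoids
    dividing by a possibly zero \<open>C\<close>.\<close>
  define h where "h = min (\<tau> / 2) (\<delta> / (2 * (C + 1)))"
  have h: "0 < h" using \<tau> \<delta> C by (simp add: h_def)
  have "h \<le> \<tau> / 2" unfolding h_def by (rule min.cobounded1)
  with \<tau> have h\<tau>: "h < \<tau>" by simp
  have "C * (2 * h) \<le> (C + 1) * (2 * h)" using h by (intro mult_right_mono) auto
  also have "\<dots> \<le> (C + 1) * (2 * (\<delta> / (2 * (C + 1))))"
    using C unfolding h_def by (intro mult_left_mono min.cobounded2) auto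
  also have "\<dots> = \<delta>"
  proof -
    have "C + 1 \<noteq> 0" using C by simp
    then show ?thesis by (simp add: divide_simps del: distrib_left_numeral)
  qed
  finally have Ch: "C * (2 * h) \<le> \<delta>" .
  obtain \<epsilon> where \<epsilon>: "0 < \<epsilon>" "\<epsilon> \<le> 1" "\<And>u. u \<in> {0..1} \<Longrightarrow> W \<epsilon> u (\<tau> + h) \<le> \<delta>"
    using W_small_if_extinct[of "\<tau> + h" \<delta>] extinct_after[of "\<tau> + h"] T \<tau> h \<delta> by auto
  have "moment \<alpha> \<epsilon> (\<tau> + h) \<le> \<delta>" using \<epsilon> \<alpha> \<tau> h by (intro moment_upper) auto
  moreover have "moment \<alpha> \<epsilon> (\<tau> - h) - moment \<alpha> \<epsilon> (\<tau> + h) \<le> C * (2 * h)"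
    using moment_decrease_le[of \<epsilon> \<alpha> "\<tau> - h" "\<tau> + h"] \<epsilon> \<alpha> h h\<tau> by (simp add: C_def)
  moreover have "4 * \<delta> \<le> moment \<alpha> \<epsilon> (\<tau> - h)"
    using lower[of \<epsilon> "\<tau> - h"] \<epsilon> h h\<tau> T by (simp add: \<delta>_def)
  ultimately show False using Ch \<delta> by linarith
qed

text \<open>Persistent mass forces the moment down at rate at least \<open>c\<close>. The order of
  choice matters: \<open>c\<close>, then \<open>\<epsilon>\<close> and the final time
  \<open>S\<close>, and only then \<open>\<alpha>\<close>, which depends on the boundary strip of
  this \<open>W \<epsilon>\<close> up to \<open>S\<close>.\<close>

lemma mass_vanishes_infinite:
  assumes T: "T = \<infinity>" and m: "0 < m" and mass: "\<And>t. t \<in> lifetime \<Longrightarrow> m \<le> z_right t - z_left t"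
  shows False
proof -
  have M: "1 \<le> M" by (rule one_le_M)
  \<comment> \<open>\<open>\<kappa> * (x - m / 2)\<close> is an affine minorant of
    \<open>\<Psi> x - \<Psi> 0\<close> on \<open>[0, M]\<close>, obtained from monotonicity alone.
    It replaces Jensen's inequality, as convexity of \<open>\<Psi>\<close> is not assumed.\<close>
  define \<kappa> where "\<kappa> = (\<Psi> (m / 2) - \<Psi> 0) / M"
  have \<kappa>: "0 < \<kappa>" using flux_strict[of 0 "m / 2"] m M by (simp add: \<kappa>_def)
  have \<kappa>_le: "\<kappa> * (x - m / 2) \<le> \<Psi> x - \<Psi> 0" if x: "0 \<le> x" "x \<le> M" for x
  proof (cases "x \<le> m / 2")
    case True
    then have "\<kappa> * (x - m / 2) \<le> 0" using \<kappa> by (simp add: mult_le_0_iff)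
    then show ?thesis using flux_mono[of 0 x] x by linarith
  next
    case False
    have "\<kappa> * (x - m / 2) \<le> \<kappa> * M" using \<kappa> x m by (intro mult_left_mono) auto
    also have "\<dots> = \<Psi> (m / 2) - \<Psi> 0" using M by (simp add: \<kappa>_def)
    also have "\<dots> \<le> \<Psi> x - \<Psi> 0" using flux_mono[of "m / 2" x] False m by simp
    finally show ?thesis .
  qed
  \<comment> \<open>Of the mass \<open>m\<close>, boundary layers cost at most \<open>m / 4\<close>
    and the shift in the minorant at most \<open>m / 2\<close>, leaving \<open>m / 4\<close>. The
    flux integral thus contributes at most \<open>- 2 * c\<close> and the end terms at most
    \<open>c\<close>.\<close>
  define c where "c = \<kappa> * (m / 4)"
  have c: "0 < c" using \<kappa> m by (simp add: c_def)
  obtain \<epsilon> where \<epsilon>: "0 < \<epsilon>" "\<epsilon> \<le> 1" "\<Psi> (2 * \<epsilon>) - \<Psi> 0 \<le> c / 2"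
    using flux_small[of "c / 2"] c by auto
  \<comment> \<open>Then \<open>(S - 1) * c = c + M\<close> exceeds the moment at time
    \<open>1\<close>, which is at most \<open>M\<close>.\<close>
  define S where "S = 2 + M / c"
  have S: "1 < S" using c M by (simp add: S_def add_pos_nonneg)
  obtain d where d: "0 < d" "\<And>u t. t \<in> {1..S} \<Longrightarrow> u \<in> {0..1} \<Longrightarrow> u < d \<or> 1 - d < u \<Longrightarrow>
      W \<epsilon> u t \<le> \<epsilon> + \<epsilon>"
    using W_near_boundary[of \<epsilon> 1 \<epsilon>] \<epsilon>(1) by auto
  \<comment> \<open>\<open>\<alpha> < d\<close> puts both ends into the strip where
    \<open>W \<epsilon> \<le> 2 * \<epsilon>\<close>; the last bound limits the mass lost to
    \<open>m / 4\<close>.\<close>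
  define \<alpha> where "\<alpha> = min (min (1 / 8) (d / 2)) (m / (8 * M))"
  have \<alpha>: "0 < \<alpha>" "\<alpha> \<le> 1 / 8" "\<alpha> < d" using m M d by (auto simp: \<alpha>_def)
  have "M * \<alpha> \<le> M * (m / (8 * M))" using M by (intro mult_left_mono) (auto simp: \<alpha>_def)
  then have \<alpha>M: "2 * M * \<alpha> \<le> m / 4" using M by simp
  obtain t where t: "1 < t" "t < S" "moment \<alpha> \<epsilon> S - moment \<alpha> \<epsilon> 1 = (S - 1) *
      ((1 - 2 * \<alpha>) * (\<Psi> (W \<epsilon> \<alpha> t) + \<Psi> (W \<epsilon> (1 - \<alpha>) t))
        - 2 * integral {\<alpha>..1 - \<alpha>} (\<lambda>u. \<Psi> (W \<epsilon> u t)))" (is "_ = _ * (_ * (?a + ?b) - 2 * ?i)")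
  proof -
    have "(moment \<alpha> \<epsilon> has_real_derivative
       (1 - 2 * \<alpha>) * (\<Psi> (W \<epsilon> \<alpha> t) + \<Psi> (W \<epsilon> (1 - \<alpha>) t))
        - 2 * integral {\<alpha>..1 - \<alpha>} (\<lambda>u. \<Psi> (W \<epsilon> u t))) (at t)" if "1 \<le> t" for t
      using \<epsilon> \<alpha> that by (intro moment_deriv) auto
    from MVT2[OF S this] that show thesis by blast
  qed
  have tl: "t \<in> lifetime" using t T by simp
  have pos: "0 \<le> W \<epsilon> u t" if "u \<in> {0..1}" for u using W_ge[of \<epsilon> u t] that \<epsilon> t by auto
  have "?a \<le> \<Psi> (2 * \<epsilon>)" "?b \<le> \<Psi> (2 * \<epsilon>)"
    using d(2)[of t \<alpha>] d(2)[of t "1 - \<alpha>"] t \<alpha> by (auto intro!: flux_mono pos)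
  then have "?a + ?b - 2 * \<Psi> 0 \<le> c" using \<epsilon>(3) by linarith
  then have "(1 - 2 * \<alpha>) * (?a + ?b - 2 * \<Psi> 0) \<le> (1 - 2 * \<alpha>) * c"
    using \<alpha> by (intro mult_left_mono) auto
  also have "\<dots> \<le> 1 * c" using \<alpha> c by (intro mult_right_mono) auto
  finally have bd: "(1 - 2 * \<alpha>) * (?a + ?b) - 2 * ((1 - 2 * \<alpha>) * \<Psi> 0) \<le> c"
    by (simp add: algebra_simps)
  have "\<kappa> * (z (1 - \<alpha>) t - z \<alpha> t - (1 - 2 * \<alpha>) * (m / 2)) \<le> ?i - (1 - 2 * \<alpha>) * \<Psi> 0"
  proof (rule has_integral_le)
    show "((\<lambda>u. \<Psi> (W \<epsilon> u t) - \<Psi> 0) has_integral (?i - (1 - 2 * \<alpha>) * \<Psi> 0)) {\<alpha>..1 - \<alpha>}"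
      using has_integral_const_real[of "\<Psi> 0" \<alpha> "1 - \<alpha>"] \<epsilon> \<alpha> t
      by (intro has_integral_diff integrable_integral flux_W_integrable) auto
    show "((\<lambda>u. \<kappa> * (w u t - m / 2)) has_integral
        \<kappa> * (z (1 - \<alpha>) t - z \<alpha> t - (1 - 2 * \<alpha>) * (m / 2))) {\<alpha>..1 - \<alpha>}"
      using has_integral_const_real[of "m / 2" \<alpha> "1 - \<alpha>"] \<alpha>
      by (intro has_integral_mult_right has_integral_diff w_has_integral tl) auto
    fix u assume "u \<in> {\<alpha>..1 - \<alpha>}"
    then have dom: "(u, t) \<in> par_dom" using \<alpha> t by (intro par_domI) auto
    have "\<kappa> * (w u t - m / 2) \<le> \<Psi> (w u t) - \<Psi> 0"
      using \<kappa>_le[OF w_nonneg[OF dom] w_le[OF dom]] .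
    also have "\<dots> \<le> \<Psi> (W \<epsilon> u t) - \<Psi> 0"
      using flux_mono[OF w_nonneg[OF dom] w_le_W[OF \<epsilon>(1) dom]] by simp
    finally show "\<kappa> * (w u t - m / 2) \<le> \<Psi> (W \<epsilon> u t) - \<Psi> 0" .
  qed
  moreover have "c \<le> \<kappa> * (z (1 - \<alpha>) t - z \<alpha> t - (1 - 2 * \<alpha>) * (m / 2))"
  proof -
    have "(1 - 2 * \<alpha>) * (m / 2) \<le> 1 * (m / 2)" using \<alpha> m by (intro mult_right_mono) auto
    then have "m / 4 \<le> z (1 - \<alpha>) t - z \<alpha> t - (1 - 2 * \<alpha>) * (m / 2)"
      using mass_interior_ge[OF tl, of \<alpha>] mass[OF tl] \<alpha> \<alpha>M by linarith
    then show ?thesis using \<kappa> unfolding c_def by (intro mult_left_mono) auto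
  qed
  ultimately have "(1 - 2 * \<alpha>) * (?a + ?b) - 2 * ?i \<le> - c" using bd by linarith
  then have "(S - 1) * ((1 - 2 * \<alpha>) * (?a + ?b) - 2 * ?i) \<le> (S - 1) * (- c)"
    using S by (intro mult_left_mono) auto
  then have "moment \<alpha> \<epsilon> S \<le> moment \<alpha> \<epsilon> 1 - (S - 1) * c" using t(3) by simp
  moreover have "moment \<alpha> \<epsilon> 1 \<le> M" using \<epsilon> \<alpha> by (intro moment_upper W_le) auto
  moreover have "0 \<le> moment \<alpha> \<epsilon> S" using \<epsilon> \<alpha> S by (intro moment_nonneg) auto
  moreover have "(S - 1) * c = c + M" using c by (simp add: S_def field_simps)
  ultimately show False using c by linarith
qed

lemma mass_vanishes:
  assumes m: "0 < m"
  obtains t where "t \<in> lifetime" "z_right t - z_left t < m"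
proof (rule ccontr)
  assume "\<not> thesis"
  then have mass: "m \<le> z_right t - z_left t" if "t \<in> lifetime" for t
    using that \<open>\<And>t. t \<in> lifetime \<Longrightarrow> z_right t - z_left t < m \<Longrightarrow> thesis\<close> by (meson not_le)
  show False
  proof (cases T)
    case (real \<tau>)
    then show False using mass_vanishes_finite m mass by blast
  next
    case PInf
    then show False using mass_vanishes_infinite m mass by blast
  next
    case MInf
    then show False using T_pos by simp
  qed
qed

text \<open>The mass is positive and nonincreasing, so one small value controls all later times
  before \<open>T\<close>.\<close>

lemma mass_tendsto_0:
  "(((\<lambda>t. z_right t - z_left t) \<circ> real_of_ereal) \<longlongrightarrow> 0) (at_left T)"
proof (rule tendstoI)
  fix e :: real assume "0 < e"
  then obtain t where t: "t \<in> lifetime" "z_right t - z_left t < e"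
    using mass_vanishes by blast
  have "dist (((\<lambda>t. z_right t - z_left t) \<circ> real_of_ereal) x) 0 < e" if "ereal t < x" "x < T" for x
  proof (cases x)
    case (real s)
    then have s: "s \<in> lifetime" "t \<le> s" using that t by auto
    have "z_right s - z_left s \<le> z_right t - z_left t"
      using z_left_mono[OF t(1) s] z_right_antimono[OF t(1) s] by simp
    then show ?thesis using z_left_less_right[OF s(1)] t(2) real by (simp add: dist_real_def)
  qed (use that in auto)
  moreover have "ereal t < T" using t by simp
  ultimately show "\<forall>\<^sub>F x in at_left T. dist (((\<lambda>t. z_right t - z_left t) \<circ> real_of_ereal) x) 0 < e"
    by (subst eventually_at_left[of "ereal t"]) auto
qed

end

text \<open>The first conjunct certifies that the values chosen by \<open>Lim\<close> in
  \<open>l\<close> and \<open>r\<close> are genuine limits. The limit at \<open>T\<close> is taken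
  in \<open>ereal\<close>, which treats finite and infinite \<open>T\<close> alike.\<close>

theorem lemma6p2:
  fixes \<Phi> u0 :: "real \<Rightarrow> real" and L a b x0 :: real
    and w z X :: "real \<Rightarrow> real \<Rightarrow> real" and l r :: "real \<Rightarrow> real" and T :: ereal
  assumes Phi_smooth: "smooth_on {0<..} \<Phi>"
    and Phi_deriv: "\<And>s. 0 < s \<Longrightarrow> 0 < deriv \<Phi> s"
    and Phi_inf: "(\<Phi> \<longlongrightarrow> L) at_top"
    and ab: "a < b"
    and u0_cont: "continuous_on {a..b} u0"
    and u0_mono: "strict_mono_on {a..b} u0"
    and u0_ends: "u0 a = 0" "u0 b = 1"
    and u0_diff: "\<And>x. x \<in> {a<..<b} \<Longrightarrow> u0 differentiable (at x)"
    and u0_C1: "continuous_on {a<..<b} (deriv u0)"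
    and u0_lower: "\<exists>c>0. \<forall>x\<in>{a<..<b}. c \<le> deriv u0 x"
    and w_sol: "conj_solution (conj_flux \<Phi> L) (conj_init a b u0) w"
    and T_def: "T = extinction_time w"
    and T_pos: "0 < T"
    and z_int: "integrated_function (conj_flux \<Phi> L) w T z"
    and x0: "x0 \<in> {a<..<b}" "u0 x0 = 1/2"
    and X_def: "X = (\<lambda>u t. x0 + z u t)"
    and l_def: "l = left_curve X"
    and r_def: "r = right_curve X"
  shows "(\<forall>t. 0 < t \<and> ereal t < T \<longrightarrow>
            ((\<lambda>u. X u t) \<longlongrightarrow> l t) (at_right 0) \<and> ((\<lambda>u. X u t) \<longlongrightarrow> r t) (at_left 1)) \<and>
         continuous_on {t. 0 < t \<and> ereal t < T} l \<and>
         continuous_on {t. 0 < t \<and> ereal t < T} r \<and>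
         mono_on {t. 0 < t \<and> ereal t < T} l \<and>
         antimono_on {t. 0 < t \<and> ereal t < T} r \<and>
         (\<forall>t. 0 < t \<and> ereal t < T \<longrightarrow> a \<le> l t \<and> l t < r t \<and> r t \<le> b) \<and>
         (((\<lambda>t. r t - l t) \<circ> real_of_ereal) \<longlongrightarrow> 0) (at_left T)"
proof -
  let ?\<Psi> = "conj_flux \<Phi> L" and ?w0 = "conj_init a b u0"
  obtain W where W: "\<And>\<epsilon>. 0 < \<epsilon> \<Longrightarrow> classical_solution ?\<Psi> ?w0 \<epsilon> (W \<epsilon>)"
    and W_mono: "\<And>u t. (u, t) \<in> par_dom \<Longrightarrow> mono_on {0<..} (\<lambda>\<epsilon>. W \<epsilon> u t)"
    and W_lim: "\<And>u t. (u, t) \<in> par_dom \<Longrightarrow> ((\<lambda>\<epsilon>. W \<epsilon> u t) \<longlongrightarrow> w u t) (at_right 0)"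
    using w_sol unfolding conj_solution_def by fast
  have "bounded ((\<lambda>(u, t). W 1 u t) ` par_dom)"
    using W[of 1] by (simp add: classical_solution_def)
  then obtain M where M: "\<And>x. x \<in> (\<lambda>(u, t). W 1 u t) ` par_dom \<Longrightarrow> norm x \<le> M"
    unfolding bounded_iff by blast
  have W_le: "W \<epsilon> u t \<le> M" if "0 < \<epsilon>" "\<epsilon> \<le> 1" "(u, t) \<in> par_dom" for \<epsilon> u t
  proof -
    have "W \<epsilon> u t \<le> W 1 u t" using that by (intro mono_onD[OF W_mono]) auto
    also have "\<dots> \<le> norm (W 1 u t)" by simp
    also have "\<dots> \<le> M" using that(3) by (intro M) force
    finally show ?thesis .
  qed
  interpret conjugate_potential ?\<Psi> "\<lambda>s. deriv \<Phi> (1 / s) / s\<^sup>2"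
    "deriv (\<lambda>s. deriv \<Phi> (1 / s) / s\<^sup>2)" ?w0 W w M T z
  proof unfold_locales
    note flux = Phi_smooth Phi_deriv Phi_inf
    show "strict_mono_on {0..} ?\<Psi>" by (rule conj_flux_strict_mono[OF flux])
    show "(?\<Psi> \<longlongrightarrow> ?\<Psi> 0) (at_right 0)" by (rule conj_flux_at_0[OF flux])
    show "(?\<Psi> has_real_derivative deriv \<Phi> (1 / s) / s\<^sup>2) (at s)" if "0 < s" for s
      by (rule conj_flux_deriv[OF flux that])
    show "((\<lambda>s. deriv \<Phi> (1 / s) / s\<^sup>2) has_real_derivative
        deriv (\<lambda>s. deriv \<Phi> (1 / s) / s\<^sup>2) s) (at s)" if "0 < s" for s
      by (rule conj_flux_deriv2[OF flux that])
  qed (fact W W_mono W_lim W_le T_def T_pos z_int)+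
  have X_left: "((\<lambda>u. X u t) \<longlongrightarrow> x0 + z_left t) (at_right 0)" if "0 \<le> t" "ereal t < T" for t
    unfolding X_def by (intro tendsto_intros z_left(1) that)
  have X_right: "((\<lambda>u. X u t) \<longlongrightarrow> x0 + z_right t) (at_left 1)" if "0 \<le> t" "ereal t < T" for t
    unfolding X_def by (intro tendsto_intros z_right(1) that)
  have l: "l t = x0 + z_left t" and r: "r t = x0 + z_right t" if "t \<in> lifetime" for t
    using that X_left[of t] X_right[of t]
    unfolding l_def r_def left_curve_def right_curve_def by (auto intro!: tendsto_Lim)
  have T0: "ereal 0 < T" using T_pos by (simp add: zero_ereal_def)
  \<comment> \<open>At time \<open>0\<close> the slope of \<open>z\<close> is
    \<open>conj_init\<close>, so \<open>X u 0\<close> is the inverse of \<open>u0\<close> and stays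
    in \<open>(a, b)\<close>.\<close>
  have X_initial: "X u 0 \<in> {a<..<b}" if u: "u \<in> {0<..<1}" for u
    unfolding X_def
  proof (rule inverse_function_potential[where f="\<lambda>u. z u 0", OF u0_cont u0_mono u0_ends ab u0_diff _ _ x0(1) _ u])
    show "deriv u0 x \<noteq> 0" if "x \<in> {a<..<b}" for x using u0_lower that by force
    show "((\<lambda>u. z u 0) has_real_derivative ?w0 u) (at u)" if "u \<in> {0<..<1}" for u
      using z_deriv_space[OF that _ T0] w_initial[OF that] by simp
    show "z (u0 x0) 0 = 0" using z_int unfolding integrated_function_def x0(2) by blast
  qed
  have a: "a \<le> x0 + z_left 0"
  proof (rule tendsto_lowerbound[OF X_left[OF _ T0]])
    show "\<forall>\<^sub>F u in at_right 0. a \<le> X u 0"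
      using X_initial by (auto simp: eventually_at_right_field intro!: exI[of _ 1] less_imp_le)
  qed simp_all
  have b: "x0 + z_right 0 \<le> b"
  proof (rule tendsto_upperbound[OF X_right[OF _ T0]])
    show "\<forall>\<^sub>F u in at_left 1. X u 0 \<le> b"
      using X_initial by (auto simp: eventually_at_left_field intro!: exI[of _ 0] less_imp_le)
  qed simp_all
  have sub: "lifetime \<subseteq> {t. 0 \<le> t \<and> ereal t < T}" by auto
  have "continuous_on lifetime (\<lambda>t. x0 + z_left t)"
    by (intro continuous_intros continuous_on_subset[OF z_left_continuous sub])
  then have cont_l: "continuous_on lifetime l"
    by (rule continuous_on_eq) (simp add: l)
  have "continuous_on lifetime (\<lambda>t. x0 + z_right t)"
    by (intro continuous_intros continuous_on_subset[OF z_right_continuous sub])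
  then have cont_r: "continuous_on lifetime r"
    by (rule continuous_on_eq) (simp add: r)
  have lim: "(((\<lambda>t. r t - l t) \<circ> real_of_ereal) \<longlongrightarrow> 0) (at_left T)"
  proof (rule Lim_transform_eventually[OF mass_tendsto_0])
    have "((\<lambda>t. z_right t - z_left t) \<circ> real_of_ereal) x = ((\<lambda>t. r t - l t) \<circ> real_of_ereal) x"
      if "0 < x" "x < T" for x
      using that l[of "real_of_ereal x"] r[of "real_of_ereal x"] by (cases x) auto
    then show "\<forall>\<^sub>F x in at_left T.
        ((\<lambda>t. z_right t - z_left t) \<circ> real_of_ereal) x = ((\<lambda>t. r t - l t) \<circ> real_of_ereal) x"
      \<comment> \<open>Near \<open>T\<close> the argument is positive, hence in
        \<open>lifetime\<close>, where \<open>l\<close> and \<open>r\<close> have been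
        identified.\<close>
      using T_pos by (subst eventually_at_left[of 0]) auto
  qed
  have "mono_on lifetime l" using l z_left_mono by (auto intro!: mono_onI)
  moreover have "antimono_on lifetime r" using r z_right_antimono by (auto intro!: monotone_onI)
  moreover have "a \<le> l t \<and> l t < r t \<and> r t \<le> b" if "t \<in> lifetime" for t
    using a b z_left_ge_initial[OF that] z_right_le_initial[OF that] z_left_less_right[OF that]
      l[OF that] r[OF that] by linarith
  moreover have "((\<lambda>u. X u t) \<longlongrightarrow> l t) (at_right 0) \<and> ((\<lambda>u. X u t) \<longlongrightarrow> r t) (at_left 1)"
    if "t \<in> lifetime" for t
    using X_left[of t] X_right[of t] l[OF that] r[OF that] that by simp
  ultimately show ?thesis using cont_l cont_r lim by blast
qed

end
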